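(* Let $\mathcal S=\{S_1,\dots,S_m\}$ be an IFS on $\mathbb{R}^d$ whose attractor $F$ is not contained in any $(d-1)$-dimensional hyperplane. Then any unit vector in $V_{\mathcal S}$ is an overlapping direction for $\mathcal S$. Moreover, $V_{\mathcal S}$ is invariant under the group $G=\overline{\{O_\gamma:\gamma\in\mathcal I^\ast\}}$, that is, $Ov\in V_{\mathcal S}$ for any $O\in G$ and $v\in V_{\mathcal S}$.
   Context: IFS and attractor: an IFS is a finite family $\mathcal S=\{S_1,\dots,S_m\}$ of contractive similitudes of $\mathbb{R}^d$, $S_i(x)=c_iO_ix+b_i$ with $c_i\in(0,1)$, $O_i$ a $d\times d$ orthogonal matrix, $b_i\in\mathbb{R}^d$. Its attractor is the unique nonempty compact $F$ with $F=\bigcup_{i=1}^m S_i(F)$. $\mathcal I=\{1,\dots,m\}$, $\mathcal I^\ast=\bigcup_{k\ge1}\mathcal I^k$, and for $\alpha=(i_1,\dots,i_k)\in\mathcal I^\ast$, $S_\alpha=S_{i_1}\circ\cdots\circ S_{i_k}$ and $O_\alpha=O_{i_1}\cdots O_{i_k}$. The closure $G$ is taken in the orthogonal group $O(d)$; it is a compact subgroup. Weak separation property (WSP): let $\mathcal E=\{S_\alpha^{-1}\circ S_\beta:\alpha,\beta\in\mathcal I^\ast,\alpha\ne\beta\}$, inside the group of similitudes with the topology of pointwise convergence. For $F$ not contained in any $(d-1)$-dimensional hyperplane, $\mathcal S$ satisfies the WSP if $I\notin\overline{\mathcal E\setminus\{I\}}$, where $I$ is the identity. Overlapping directions: $B(x,R)$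 is the closed ball, $\|\cdot\|_\infty$ is the sup norm on $[0,1]^d$ and $\|\cdot\|_{\mathrm{op}}$ the Euclidean operator norm. Suppose $\mathcal S$ does not satisfy the WSP. Take any sequences $\alpha_k,\beta_k\in\mathcal I^\ast$ such that $\Phi_k:=S_{\alpha_k}^{-1}\circ S_{\beta_k}-I$ satisfies $0<\|\Phi_k\|_\infty\to0$ and such that, for some $a\in F$ and $\rho>0$, $\rho\|D\Phi_k\|_{\mathrm{op}}\le\|\Phi_k(a_k)\|$ for all $k$, where $a_k$ is any point of $B(a,\rho)$ minimizing $\|\Phi_k(x)\|$ over $x\in B(a,\rho)$. Any limit point $\omega\in S^{d-1}$ of $\{\Phi_k(a)/\|\Phi_k(a)\|\}_k$, for any such choice of data, is called an overlapping direction for $\mathcal S$. $V_{\mathcal S}$ is the vector subspace of $\mathbb{R}^d$ spanned by all overlapping directions for $\mathcal S$. If $\mathcal S$ satisfies the WSP, there are no overlapping directions and $V_{\mathcal S}=\{0\}$. *)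

theory Defs
  imports "HOL-Analysis.Analysis"
begin

definition similitudes :: "(real^'n \<Rightarrow> real^'n) set" where
  "similitudes =
     {f. \<exists>c Q b. 0 < c \<and> orthogonal_matrix Q \<and> f = (\<lambda>x. c *\<^sub>R (Q *v x) + b)}"

(* The maps S i, i in {1..m}, are an indexed family: repetitions are allowed. *)
definition ifs ::
  "nat \<Rightarrow> (nat \<Rightarrow> real^'n \<Rightarrow> real^'n) \<Rightarrow>
   (nat \<Rightarrow> real) \<Rightarrow> (nat \<Rightarrow> real^'n^'n) \<Rightarrow> (nat \<Rightarrow> real^'n) \<Rightarrow> bool" where
  "ifs m S c Q b \<longleftrightarrow> 1 \<le> m \<and>
     (\<forall>i\<in>{1..m}. 0 < c i \<and> c i < 1 \<and> orthogonal_matrix (Q i) \<and>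
        S i = (\<lambda>x. c i *\<^sub>R (Q i *v x) + b i))"

definition is_attractor ::
  "nat \<Rightarrow> (nat \<Rightarrow> real^'n \<Rightarrow> real^'n) \<Rightarrow> (real^'n) set \<Rightarrow> bool" where
  "is_attractor m S F \<longleftrightarrow> compact F \<and> F \<noteq> {} \<and> F = (\<Union>i\<in>{1..m}. S i ` F)"

definition words :: "nat \<Rightarrow> nat list set" where
  "words m = {w. w \<noteq> [] \<and> set w \<subseteq> {1..m}}"

definition word_map :: "(nat \<Rightarrow> 'a \<Rightarrow> 'a) \<Rightarrow> nat list \<Rightarrow> 'a \<Rightarrow> 'a" where
  "word_map S w = foldr (\<lambda>i f. S i \<circ> f) w id"

definition word_matrix :: "(nat \<Rightarrow> real^'n^'n) \<Rightarrow> nat list \<Rightarrow> real^'n^'n" where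
  "word_matrix Q w = foldr (\<lambda>i A. Q i ** A) w (mat 1)"

definition in_some_hyperplane :: "(real^'n) set \<Rightarrow> bool" where
  "in_some_hyperplane F \<longleftrightarrow>
     (\<exists>H. affine H \<and> aff_dim H = int CARD('n) - 1 \<and> F \<subseteq> H)"

definition neighbour_maps ::
  "nat \<Rightarrow> (nat \<Rightarrow> real^'n \<Rightarrow> real^'n) \<Rightarrow> (real^'n \<Rightarrow> real^'n) set" where
  "neighbour_maps m S =
     {inv (word_map S \<alpha>) \<circ> word_map S \<beta> |\<alpha> \<beta>. \<alpha> \<in> words m \<and> \<beta> \<in> words m \<and> \<alpha> \<noteq> \<beta>}"

(* The topology on the function type is the product topology, i.e. that of
   pointwise convergence. *)
definition weak_separation :: "nat \<Rightarrow> (nat \<Rightarrow> real^'n \<Rightarrow> real^'n) \<Rightarrow> bool" where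
  "weak_separation m S \<longleftrightarrow>
     id \<notin> (top_of_set similitudes) closure_of (neighbour_maps m S - {id})"

definition displacement ::
  "(nat \<Rightarrow> real^'n \<Rightarrow> real^'n) \<Rightarrow> nat list \<Rightarrow> nat list \<Rightarrow> real^'n \<Rightarrow> real^'n" where
  "displacement S \<alpha> \<beta> x = (inv (word_map S \<alpha>) \<circ> word_map S \<beta>) x - x"

definition cube_sup_norm :: "(real^'n \<Rightarrow> real^'n) \<Rightarrow> real" where
  "cube_sup_norm f = (SUP x\<in>cbox 0 1. norm (f x))"

(* The displacements are affine, so their derivative is the same at every point;
   it is taken at 0.  A limit point of a sequence is the limit of a subsequence. *)
definition overlapping_direction ::
  "nat \<Rightarrow> (nat \<Rightarrow> real^'n \<Rightarrow> real^'n) \<Rightarrow> (real^'n) set \<Rightarrow> real^'n \<Rightarrow> bool" where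
  "overlapping_direction m S F \<omega> \<longleftrightarrow>
     \<not> weak_separation m S \<and>
     (\<exists>(\<alpha> :: nat \<Rightarrow> nat list) (\<beta> :: nat \<Rightarrow> nat list) \<Phi> a \<rho> (p :: nat \<Rightarrow> real^'n) (r :: nat \<Rightarrow> nat).
        (\<forall>k. \<alpha> k \<in> words m \<and> \<beta> k \<in> words m) \<and>
        (\<forall>k. \<Phi> k = displacement S (\<alpha> k) (\<beta> k)) \<and>
        (\<forall>k. 0 < cube_sup_norm (\<Phi> k)) \<and>
        (\<lambda>k. cube_sup_norm (\<Phi> k)) \<longlonglongrightarrow> 0 \<and>
        a \<in> F \<and> 0 < \<rho> \<and>
        (\<forall>k. is_arg_min (\<lambda>x. norm (\<Phi> k x)) (\<lambda>x. x \<in> cball a \<rho>) (p k)) \<and>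
        (\<forall>k. \<rho> * onorm (frechet_derivative (\<Phi> k) (at 0)) \<le> norm (\<Phi> k (p k))) \<and>
        \<omega> \<in> sphere 0 1 \<and> strict_mono r \<and>
        (\<lambda>k. \<Phi> (r k) a /\<^sub>R norm (\<Phi> (r k) a)) \<longlonglongrightarrow> \<omega>)"

definition overlap_space ::
  "nat \<Rightarrow> (nat \<Rightarrow> real^'n \<Rightarrow> real^'n) \<Rightarrow> (real^'n) set \<Rightarrow> (real^'n) set" where
  "overlap_space m S F = span {\<omega>. overlapping_direction m S F \<omega>}"

definition rotation_group :: "nat \<Rightarrow> (nat \<Rightarrow> real^'n^'n) \<Rightarrow> (real^'n^'n) set" where
  "rotation_group m Q =
     (top_of_set {A. orthogonal_matrix A}) closure_of (word_matrix Q ` words m)"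

end

theory Submission
  imports Defs
begin

text \<open>Call \<open>v\<close> a translation limit if suitable multiples of the displacements, with factors tending
  to infinity, converge to the constant \<open>v\<close> together with their derivatives. Conjugating
  \<open>S\<^sub>\<alpha>\<inverse> S\<^sub>\<beta>\<close> by \<open>S\<^sub>\<gamma>\<close> turns \<open>v\<close> into \<open>O\<^sub>\<gamma>\<inverse> v\<close>, and powers of an orthogonal matrix return
  to the identity, so the translation limits are invariant under the rotation group. Exchanging
  \<open>\<alpha>\<close> and \<open>\<beta>\<close> gives \<open>- v\<close>. Although compositions of the maps \<open>S\<^sub>\<alpha>\<inverse> S\<^sub>\<beta>\<close> are not of this
  form, \<open>S\<^sub>\<alpha>\<^sub>'\<^sub>\<alpha>\<inverse> S\<^sub>\<beta>\<^sub>'\<^sub>\<beta>\<close> adds to the displacement of \<open>S\<^sub>\<alpha>\<inverse> S\<^sub>\<beta>\<close> a rotated and rescaled copy of that of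
  \<open>S\<^sub>\<alpha>\<^sub>'\<inverse> S\<^sub>\<beta>\<^sub>'\<close>. The size of the copy can only be chosen up to a bounded factor, so \<open>v + w\<close> is
  reached by adding many small increments in the direction of \<open>w\<close>. Hence the translation limits
  form an invariant subspace, whose unit vectors are exactly the overlapping directions.\<close>

section \<open>Orthogonal matrices\<close>

declare transpose_matrix_vector [simp del]

text \<open>The norm of a matrix is here the Euclidean norm of its row norms, not the operator norm,
  so Cauchy-Schwarz applied row by row suffices.\<close>

lemma norm_matrix_vector_le: "norm (A *v x) \<le> norm A * norm x"
  for A :: "real^'n^'m"
proof -
  have "norm (A *v x) = L2_set (\<lambda>i. \<bar>(A $ i) \<bullet> x\<bar>) UNIV"
    by (simp add: norm_vec_def matrix_vector_mult_def inner_vec_def)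
  also have "\<dots> \<le> L2_set (\<lambda>i. norm (A $ i) * norm x) UNIV"
    by (intro L2_set_mono) (auto intro: Cauchy_Schwarz_ineq2)
  also have "\<dots> = norm A * norm x"
    by (simp add: norm_vec_def[of A] L2_set_left_distrib)
  finally show ?thesis .
qed

lemma norm_orthogonal_matrix_vector: "norm (A *v x) = norm x"
  if "orthogonal_matrix A" for A :: "real^'n^'n"
  using that orthogonal_transformation_matrix[of "\<lambda>x. A *v x"]
  by (simp add: orthogonal_transformation_norm)

lemma norm_orthogonal_matrix_le: "norm A \<le> CARD('n)"
  if "orthogonal_matrix A" for A :: "real^'n^'n"
proof -
  have "norm (A $ i) = 1" for i
    using that orthogonal_matrix_orthonormal_rows[of A] by (simp add: row_def)
  then show ?thesis
    unfolding norm_vec_def[of A] using L2_set_le_sum[of UNIV "\<lambda>i. norm (A $ i)"] by simp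
qed

lemma transpose_matrix_vector_cancel:
  fixes A :: "real^'n^'n"
  assumes "orthogonal_matrix A"
  shows "transpose A *v (A *v x) = x" "A *v (transpose A *v x) = x"
  using assms by (simp_all add: orthogonal_matrix_def matrix_vector_mul_assoc)

lemma matrix_sandwich_cancel_norm:
  fixes A :: "real^'n^'n"
  assumes "orthogonal_matrix A"
  shows "norm (transpose A *v (B *v (A *v x)) - x) = norm (B *v (A *v x) - A *v x)"
proof -
  have "transpose A *v (B *v (A *v x)) - x = transpose A *v (B *v (A *v x) - A *v x)"
    using assms by (simp add: transpose_matrix_vector_cancel matrix_vector_mult_diff_distrib)
  then show ?thesis
    using assms by (simp add: norm_orthogonal_matrix_vector)
qed

text \<open>The bound on the return time does not depend on the vector: the powers of the matrix
  form a totally bounded set.\<close>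

lemma orthogonal_power_recurrence:
  fixes A :: "real^'n^'n"
  assumes "orthogonal_matrix A" "0 < \<eta>"
  obtains N where "\<And>n. \<exists>q\<le>N. q \<le> n \<and>
    (\<forall>u. norm (((\<lambda>x. A *v x) ^^ (n - q)) u - u) \<le> \<eta> * norm u)"
proof -
  define P where "P n = ((\<lambda>B. A ** B) ^^ n) (mat 1)" for n
  have P: "((\<lambda>x. A *v x) ^^ n) u = P n *v u" for n u
    by (induction n) (simp_all add: P_def matrix_vector_mul_assoc)
  have orth: "orthogonal_matrix (P n)" for n
    by (induction n) (simp_all add: P_def assms orthogonal_matrix_mul orthogonal_matrix_id)
  have "bounded (range P)"
    unfolding bounded_iff using norm_orthogonal_matrix_le[OF orth] by blast
  then have "compact (closure (range P))"
    by (simp add: compact_closure)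
  moreover have "closure (range P) \<subseteq> (\<Union>n\<in>UNIV. ball (P n) \<eta>)"
    using assms(2) by (fastforce simp: closure_approachable)
  \<comment> \<open>The balls are centred at powers of \<open>A\<close>, so a finite subcover is a
    finite set of exponents. Its maximum serves as \<open>N\<close>.\<close>
  ultimately obtain C where C: "finite C" "closure (range P) \<subseteq> (\<Union>n\<in>C. ball (P n) \<eta>)"
    using compactE_image[of "closure (range P)" UNIV "\<lambda>n. ball (P n) \<eta>"] by (metis open_ball)
  have "\<exists>q\<le>Max C. q \<le> n \<and>
      (\<forall>u. norm (((\<lambda>x. A *v x) ^^ (n - q)) u - u) \<le> \<eta> * norm u)" for n
  proof -
    have "P n \<in> closure (range P)"
      by (rule subsetD[OF closure_subset]) simp
    then obtain q where q: "q \<in> C" "dist (P q) (P n) < \<eta>"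
      using C(2) by auto
    show ?thesis
    proof (cases "q \<le> n")
      case True
      have "norm (((\<lambda>x. A *v x) ^^ (n - q)) u - u) \<le> \<eta> * norm u" for u
      proof -
        have "P n *v u = P q *v (P (n - q) *v u)"
          using True funpow_add[of q "n - q" "\<lambda>x. A *v x"] by (simp flip: P)
        then have "(P n - P q) *v u = P q *v (P (n - q) *v u - u)"
          by (simp add: algebra_simps)
        then have "norm (P (n - q) *v u - u) = norm ((P n - P q) *v u)"
          using norm_orthogonal_matrix_vector[OF orth] by metis
        also have "\<dots> \<le> norm (P n - P q) * norm u"
          by (rule norm_matrix_vector_le)
        also have "\<dots> \<le> \<eta> * norm u"
          using q(2) by (intro mult_right_mono) (auto simp: dist_norm norm_minus_commute)
        finally show ?thesis
          by (simp add: P)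
      qed
      then show ?thesis
        using True Max_ge[OF C(1) q(1)] by blast
    next
      case False
      \<comment> \<open>When the centre of the ball has an exponent beyond \<open>n\<close>, the
        choice \<open>q = n\<close> leaves the zeroth power, which is the identity.\<close>
      have "n \<le> Max C"
        using False Max_ge[OF C(1) q(1)] by linarith
      then show ?thesis
        using assms(2) by (intro exI[of _ n]) auto
    qed
  qed
  then show thesis
    using that by blast
qed

text \<open>Recurrence at the exponent \<open>Suc N\<close>, with at most \<open>N\<close> factors
  removed, leaves a positive power. Positivity matters later: one factor is cancelled against its
  inverse, or one copy of a word does the zooming.\<close>

lemma orthogonal_power_return:
  fixes A :: "real^'n^'n"
  assumes "orthogonal_matrix A" "0 < \<eta>"
  obtains n where "norm (((\<lambda>x. A *v x) ^^ Suc n) u - u) \<le> \<eta>"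
proof -
  have pos: "0 < \<eta> / (norm u + 1)"
    by (simp add: add_nonneg_pos assms(2))
  obtain N where N: "\<And>n. \<exists>q\<le>N. q \<le> n \<and>
      (\<forall>v. norm (((\<lambda>x. A *v x) ^^ (n - q)) v - v) \<le> \<eta> / (norm u + 1) * norm v)"
    using orthogonal_power_recurrence[OF assms(1) pos] by blast
  obtain q where q: "q \<le> N"
    and "norm (((\<lambda>x. A *v x) ^^ (Suc N - q)) u - u) \<le> \<eta> / (norm u + 1) * norm u"
    using N[of "Suc N"] by blast
  moreover have "\<eta> / (norm u + 1) * norm u \<le> \<eta> / (norm u + 1) * (norm u + 1)"
    using pos by (intro mult_left_mono) auto
  moreover have "\<eta> / (norm u + 1) * (norm u + 1) = \<eta>"
    using norm_ge_zero[of u] by (simp del: norm_ge_zero)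
  ultimately show thesis
    using that[of "N - q"] by (metis Suc_diff_le order.trans)
qed

section \<open>Word maps and displacements\<close>

locale self_similar =
  fixes m :: nat
    and S :: "nat \<Rightarrow> real^'n \<Rightarrow> real^'n"
    and c :: "nat \<Rightarrow> real"
    and Q :: "nat \<Rightarrow> real^'n^'n"
    and b :: "nat \<Rightarrow> real^'n"
    and F :: "(real^'n) set"
  assumes ifs: "ifs m S c Q b"
    and attractor: "is_attractor m S F"
begin

abbreviation ratio :: "nat list \<Rightarrow> real" where
  "ratio w \<equiv> prod_list (map c w)"

abbreviation rot :: "nat list \<Rightarrow> real^'n^'n" where
  "rot w \<equiv> word_matrix Q w"

abbreviation "W \<equiv> lists {1..m}"

section \<open>Word maps as similitudes\<close>

lemma generator:
  assumes "i \<in> {1..m}"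
  shows "0 < c i" "c i < 1" "orthogonal_matrix (Q i)" "S i x = c i *\<^sub>R (Q i *v x) + b i"
  using ifs assms by (auto simp: ifs_def)

lemma one_in_range: "1 \<in> {1..m}"
  using ifs by (simp add: ifs_def)

lemma words_iff: "w \<in> words m \<longleftrightarrow> w \<noteq> [] \<and> w \<in> W"
  by (auto simp: words_def)

lemma words_append: "u \<in> words m \<Longrightarrow> v \<in> W \<Longrightarrow> u @ v \<in> words m"
  by (auto simp: words_def)

lemma word_map_simps [simp]:
  "word_map S [] x = x" "word_map S (i # w) x = S i (word_map S w x)"
  by (simp_all add: word_map_def)

lemma word_map_append: "word_map S (u @ v) x = word_map S u (word_map S v x)"
  by (induction u) simp_all

lemma word_matrix_simps [simp]:
  "rot [] = mat 1" "rot (i # w) = Q i ** rot w"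
  by (simp_all add: word_matrix_def)

lemma word_matrix_append: "rot (u @ v) = rot u ** rot v"
  by (induction u) (simp_all add: matrix_mul_assoc)

lemma orthogonal_rot: "w \<in> W \<Longrightarrow> orthogonal_matrix (rot w)"
  by (induction w) (auto simp: orthogonal_matrix_id orthogonal_matrix_mul generator)

lemma ratio_pos: "w \<in> W \<Longrightarrow> 0 < ratio w"
  by (induction w) (auto simp: generator)

lemma ratio_le_1: "w \<in> W \<Longrightarrow> ratio w \<le> 1"
proof (induction w)
  case (Cons i w)
  then show ?case
    using generator[of i] ratio_pos[of w] mult_mono[of "c i" 1 "ratio w" 1] by simp
qed simp

lemma word_map_diff:
  assumes "w \<in> W"
  shows "word_map S w x - word_map S w y = ratio w *\<^sub>R (rot w *v (x - y))"
  using assms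
proof (induction w)
  case (Cons i w)
  then have "word_map S (i # w) x - word_map S (i # w) y
      = c i *\<^sub>R (Q i *v (word_map S w x - word_map S w y))"
    by (simp add: generator algebra_simps)
  also have "\<dots> = ratio (i # w) *\<^sub>R (rot (i # w) *v (x - y))"
    using Cons by (simp add: matrix_vector_mult_scaleR matrix_vector_mul_assoc)
  finally show ?case .
qed simp

lemma norm_word_map_diff:
  "w \<in> W \<Longrightarrow> norm (word_map S w x - word_map S w y) = ratio w * norm (x - y)"
  using word_map_diff[of w x y] ratio_pos[of w]
  by (simp add: norm_orthogonal_matrix_vector orthogonal_rot)

lemma inj_word_map:
  assumes "w \<in> W"
  shows "inj (word_map S w)"
proof (rule injI)
  fix x y
  assume "word_map S w x = word_map S w y"
  then have "ratio w * norm (x - y) = 0"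
    using norm_word_map_diff[OF assms, of x y] by simp
  then show "x = y"
    using ratio_pos[OF assms] by simp
qed

lemma surj_word_map:
  assumes "w \<in> W"
  shows "surj (word_map S w)"
proof (rule surjI)
  fix y
  define z where "z = (1 / ratio w) *\<^sub>R (transpose (rot w) *v (y - word_map S w 0))"
  have "word_map S w z - word_map S w 0 = y - word_map S w 0"
    using ratio_pos[OF assms]
    by (simp add: word_map_diff[OF assms] z_def matrix_vector_mult_scaleR
        transpose_matrix_vector_cancel orthogonal_rot[OF assms])
  then show "word_map S w ((1 / ratio w) *\<^sub>R (transpose (rot w) *v (y - word_map S w 0))) = y"
    by (simp add: z_def)
qed

section \<open>Displacements of pairs of words\<close>

lemma word_map_displacement:
  "\<alpha> \<in> W \<Longrightarrow> word_map S \<alpha> (x + displacement S \<alpha> \<beta> x) = word_map S \<beta> x"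
  by (simp add: displacement_def surj_f_inv_f surj_word_map)

text \<open>Injectivity of the word map reduces each formula for a displacement to an identity
  between word maps, in which no inverse occurs.\<close>

lemma displacement_unique:
  assumes "\<alpha> \<in> W" "word_map S \<alpha> (x + d) = word_map S \<beta> x"
  shows "displacement S \<alpha> \<beta> x = d"
proof -
  have "word_map S \<alpha> (x + displacement S \<alpha> \<beta> x) = word_map S \<alpha> (x + d)"
    by (simp add: word_map_displacement[OF assms(1)] assms(2))
  then have "x + displacement S \<alpha> \<beta> x = x + d"
    by (rule injD[OF inj_word_map[OF assms(1)]])
  then show ?thesis
    by simp
qed

lemma displacement_self [simp]: "\<alpha> \<in> W \<Longrightarrow> displacement S \<alpha> \<alpha> x = 0"
  by (rule displacement_unique) simp_all

text \<open>Appending \<open>\<gamma>\<close> on the right to both words conjugates the neighbour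
  map by the similitude of \<open>\<gamma>\<close>. Values are magnified and rotated, while the size
  of the derivative is unchanged.\<close>

lemma displacement_append_right:
  assumes "\<alpha> \<in> W" "\<gamma> \<in> W"
  shows "displacement S (\<alpha> @ \<gamma>) (\<beta> @ \<gamma>) x
    = (1 / ratio \<gamma>) *\<^sub>R (transpose (rot \<gamma>) *v displacement S \<alpha> \<beta> (word_map S \<gamma> x))"
    (is "_ = ?d")
proof (rule displacement_unique)
  have "word_map S \<gamma> (x + ?d) - word_map S \<gamma> x = displacement S \<alpha> \<beta> (word_map S \<gamma> x)"
    using ratio_pos[OF assms(2)]
    by (simp add: word_map_diff[OF assms(2)] matrix_vector_mult_scaleR
        transpose_matrix_vector_cancel orthogonal_rot[OF assms(2)])
  then have "word_map S \<gamma> (x + ?d) = word_map S \<gamma> x + displacement S \<alpha> \<beta> (word_map S \<gamma> x)"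
    by (simp add: algebra_simps)
  then show "word_map S (\<alpha> @ \<gamma>) (x + ?d) = word_map S (\<beta> @ \<gamma>) x"
    by (simp add: word_map_append word_map_displacement[OF assms(1)])
qed (use assms in auto)

text \<open>The outer pair moves the point \<open>word_map S \<beta> x\<close>, and the inverse of
  the map of \<open>\<alpha>\<close> then magnifies and rotates this movement. This is the source of
  sums of displacements.\<close>

lemma displacement_append_left:
  assumes "\<alpha> \<in> W" "\<alpha>' \<in> W" "\<beta> \<in> W"
  shows "displacement S (\<alpha>' @ \<alpha>) (\<beta>' @ \<beta>) x = displacement S \<alpha> \<beta> x
    + (1 / ratio \<alpha>) *\<^sub>R (transpose (rot \<alpha>) *v displacement S \<alpha>' \<beta>' (word_map S \<beta> x))"
    (is "_ = _ + ?d")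
proof (rule displacement_unique)
  let ?y = "x + displacement S \<alpha> \<beta> x"
  have y: "word_map S \<alpha> ?y = word_map S \<beta> x"
    by (rule word_map_displacement[OF assms(1)])
  have "word_map S \<alpha> (?y + ?d) - word_map S \<alpha> ?y = displacement S \<alpha>' \<beta>' (word_map S \<beta> x)"
    using ratio_pos[OF assms(1)]
    by (simp add: word_map_diff[OF assms(1)] matrix_vector_mult_scaleR
        transpose_matrix_vector_cancel orthogonal_rot[OF assms(1)])
  then have "word_map S \<alpha> (?y + ?d) = word_map S \<beta> x + displacement S \<alpha>' \<beta>' (word_map S \<beta> x)"
    using y by (simp add: algebra_simps)
  then show "word_map S (\<alpha>' @ \<alpha>) (x + (displacement S \<alpha> \<beta> x + ?d)) = word_map S (\<beta>' @ \<beta>) x"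
    by (simp add: word_map_append word_map_displacement[OF assms(2)] flip: add.assoc)
qed (use assms in auto)

text \<open>Exchanging the words inverts the neighbour map, so the displacement changes sign but is
  read off at the preimage \<open>y\<close> of \<open>x\<close>.\<close>

lemma displacement_swap:
  assumes "\<alpha> \<in> W" "\<beta> \<in> W"
  obtains y where "y + displacement S \<alpha> \<beta> y = x" "displacement S \<beta> \<alpha> x = - displacement S \<alpha> \<beta> y"
proof -
  obtain y where y: "word_map S \<beta> y = word_map S \<alpha> x"
    using surj_word_map[OF assms(2)] by (metis surjD)
  have d: "displacement S \<alpha> \<beta> y = x - y"
    by (rule displacement_unique) (use assms y in auto)
  moreover have "displacement S \<beta> \<alpha> x = y - x"
    by (rule displacement_unique) (use assms y in auto)
  ultimately show thesis
    by (intro that[of y]) auto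
qed

text \<open>The linear part of the neighbour map minus the identity, hence the derivative of the
  displacement.\<close>

definition displacement_matrix :: "nat list \<Rightarrow> nat list \<Rightarrow> real^'n^'n" where
  "displacement_matrix \<alpha> \<beta> = (ratio \<beta> / ratio \<alpha>) *\<^sub>R (transpose (rot \<alpha>) ** rot \<beta>) - mat 1"

lemma displacement_affine:
  assumes "\<alpha> \<in> W" "\<beta> \<in> W"
  shows "displacement S \<alpha> \<beta> x = displacement S \<alpha> \<beta> y + displacement_matrix \<alpha> \<beta> *v (x - y)"
proof -
  let ?d = "displacement S \<alpha> \<beta>"
  have "ratio \<alpha> *\<^sub>R (rot \<alpha> *v ((x - y) + (?d x - ?d y)))
      = word_map S \<alpha> (x + ?d x) - word_map S \<alpha> (y + ?d y)"
    unfolding word_map_diff[OF assms(1)] by (simp add: algebra_simps)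
  also have "\<dots> = ratio \<beta> *\<^sub>R (rot \<beta> *v (x - y))"
    by (simp add: word_map_displacement[OF assms(1)] word_map_diff[OF assms(2)])
  finally have "(1 / ratio \<alpha>) *\<^sub>R (transpose (rot \<alpha>) *v (ratio \<alpha> *\<^sub>R (rot \<alpha> *v ((x - y) + (?d x - ?d y)))))
      = (1 / ratio \<alpha>) *\<^sub>R (transpose (rot \<alpha>) *v (ratio \<beta> *\<^sub>R (rot \<beta> *v (x - y))))"
    by (rule arg_cong)
  then have "(x - y) + (?d x - ?d y)
      = ((ratio \<beta> / ratio \<alpha>) *\<^sub>R (transpose (rot \<alpha>) ** rot \<beta>)) *v (x - y)"
    using ratio_pos[OF assms(1)]
      orthogonal_rot[OF assms(1), unfolded orthogonal_matrix]
    by (simp add: matrix_vector_mult_scaleR matrix_vector_mul_assoc flip: scaleR_matrix_vector_assoc)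
  then show ?thesis
    by (simp add: displacement_matrix_def matrix_vector_mult_diff_rdistrib algebra_simps)
qed

lemma displacement_has_derivative:
  assumes "\<alpha> \<in> W" "\<beta> \<in> W"
  shows "(displacement S \<alpha> \<beta> has_derivative (\<lambda>x. displacement_matrix \<alpha> \<beta> *v x)) (at z)"
proof -
  have "((\<lambda>x. displacement S \<alpha> \<beta> 0 + displacement_matrix \<alpha> \<beta> *v (x - 0)) has_derivative
      (\<lambda>x. displacement_matrix \<alpha> \<beta> *v x)) (at z)"
    by (auto intro!: derivative_eq_intros bounded_linear.has_derivative
        [OF matrix_vector_mul_bounded_linear])
  then show ?thesis
    by (simp only: displacement_affine[OF assms, of _ 0, symmetric])
qed

lemma frechet_derivative_displacement:
  assumes "\<alpha> \<in> W" "\<beta> \<in> W"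
  shows "frechet_derivative (displacement S \<alpha> \<beta>) (at 0) = (\<lambda>x. displacement_matrix \<alpha> \<beta> *v x)"
  using frechet_derivative_at[OF displacement_has_derivative[OF assms]] by simp

lemma continuous_on_displacement:
  assumes "\<alpha> \<in> W" "\<beta> \<in> W"
  shows "continuous_on X (displacement S \<alpha> \<beta>)"
  by (rule has_derivative_continuous_on[OF has_derivative_at_withinI[OF displacement_has_derivative[OF assms]]])

section \<open>The attractor and bounds uniform over words\<close>

lemma attractor_facts: "compact F" "F \<noteq> {}" "F = (\<Union>i\<in>{1..m}. S i ` F)"
  using attractor by (auto simp: is_attractor_def)

lemma word_map_attractor: "w \<in> W \<Longrightarrow> x \<in> F \<Longrightarrow> word_map S w x \<in> F"
proof (induction w)
  case (Cons i w)
  then show ?case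
    unfolding word_map_simps by (subst attractor_facts(3)) auto
qed simp

lemma attractor_address:
  assumes "a \<in> F"
  obtains \<tau> a' where "\<tau> \<in> W" "length \<tau> = n" "a' \<in> F" "a = word_map S \<tau> a'"
proof -
  have "\<exists>\<tau> a'. \<tau> \<in> W \<and> length \<tau> = n \<and> a' \<in> F \<and> a = word_map S \<tau> a'"
    using assms
  proof (induction n arbitrary: a)
    case (Suc n)
    obtain i a1 where i: "i \<in> {1..m}" "a1 \<in> F" "a = S i a1"
      using attractor_facts(3) Suc.prems by blast
    obtain \<tau> a' where "\<tau> \<in> W" "length \<tau> = n" "a' \<in> F" "a1 = word_map S \<tau> a'"
      using Suc.IH[OF i(2)] by blast
    then show ?case
      using i by (intro exI[of _ "i # \<tau>"] exI[of _ a']) auto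
  qed auto
  then show thesis
    using that by blast
qed

text \<open>The largest of the finitely many ratios is below 1, so one length works for every word.
  This permits fixing the length before the word.\<close>

lemma ratio_small:
  assumes "0 < e"
  obtains n where "\<And>w. w \<in> W \<Longrightarrow> length w = n \<Longrightarrow> ratio w < e"
proof -
  let ?r = "Max (c ` {1..m})"
  have "?r \<in> c ` {1..m}"
    using one_in_range by (intro Max_in) auto
  then have r: "0 < ?r" "?r < 1"
    using generator by auto
  then obtain n where n: "?r ^ n < e"
    using real_arch_pow_inv assms by blast
  have bound: "ratio w \<le> ?r ^ length w" if "w \<in> W" for w
    using that
  proof (induction w)
    case (Cons i w)
    then show ?case
      using r generator(1)[of i] ratio_pos[of w] by (auto intro!: mult_mono)
  qed simp
  have "ratio w < e" if "w \<in> W" "length w = n" for w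
    using bound[OF that(1)] n unfolding that(2) by (rule le_less_trans)
  then show thesis
    by (rule that)
qed

definition attractor_bound :: real where
  "attractor_bound = (SOME R. 0 < R \<and> (\<forall>x\<in>F. norm x \<le> R))"

lemma attractor_bound: "0 < attractor_bound" "x \<in> F \<Longrightarrow> norm x \<le> attractor_bound"
proof -
  have "\<exists>R. 0 < R \<and> (\<forall>x\<in>F. norm x \<le> R)"
    using compact_imp_bounded[OF attractor_facts(1)] bounded_pos by blast
  then have "0 < attractor_bound \<and> (\<forall>x\<in>F. norm x \<le> attractor_bound)"
    unfolding attractor_bound_def by (rule someI_ex)
  then show "0 < attractor_bound" "x \<in> F \<Longrightarrow> norm x \<le> attractor_bound"
    by blast+
qed

text \<open>Word maps do not expand distances and keep a point of the attractor within the
  attractor, so the bound is the same for all words.\<close>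

lemma norm_word_map_le:
  assumes "w \<in> W"
  shows "norm (word_map S w x) \<le> 2 * attractor_bound + norm x"
proof -
  obtain a where a: "a \<in> F"
    using attractor_facts(2) by blast
  have "norm (word_map S w x - word_map S w a) \<le> 1 * norm (x - a)"
    unfolding norm_word_map_diff[OF assms]
    using ratio_le_1[OF assms] by (intro mult_right_mono) auto
  moreover have "norm (word_map S w a) \<le> attractor_bound" "norm a \<le> attractor_bound"
    using attractor_bound(2) a word_map_attractor[OF assms a] by blast+
  ultimately show ?thesis
    using norm_triangle_ineq4[of x a] norm_triangle_sub[of "word_map S w x" "word_map S w a"] by linarith
qed

section \<open>Translation limits\<close>

text \<open>The displacement is affine, so this one inequality controls both its value and its
  derivative.\<close>

definition near :: "nat list \<Rightarrow> nat list \<Rightarrow> real \<Rightarrow> real \<Rightarrow> real^'n \<Rightarrow> bool" where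
  "near \<alpha> \<beta> t e v \<longleftrightarrow> (\<forall>x. norm (t *\<^sub>R displacement S \<alpha> \<beta> x - v) \<le> e * (1 + norm x))"

definition translation_limit :: "real^'n \<Rightarrow> bool" where
  "translation_limit v \<longleftrightarrow>
     (\<forall>e>0. \<forall>N. \<exists>t>N. \<exists>\<alpha>\<in>words m. \<exists>\<beta>\<in>words m. near \<alpha> \<beta> t e v)"

text \<open>Bounds the factor by which \<open>1 + norm x\<close> can grow under any word
  map.\<close>

abbreviation distortion :: real where
  "distortion \<equiv> 1 + 2 * attractor_bound"

section \<open>Calculus of approximate translations\<close>

lemma near_nonneg: "near \<alpha> \<beta> t e v \<Longrightarrow> 0 \<le> e"
  unfolding near_def by (drule spec[of _ 0]) (auto intro: order_trans[OF norm_ge_zero])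

lemma near_perturb:
  assumes "near \<alpha> \<beta> t e v" "norm (v - w) \<le> d"
  shows "near \<alpha> \<beta> t (e + d) w"
  unfolding near_def
proof
  fix x :: "real^'n"
  have "0 \<le> d * norm x"
    using assms(2) norm_ge_zero order_trans by (metis mult_nonneg_nonneg)
  moreover have "norm (t *\<^sub>R displacement S \<alpha> \<beta> x - v) \<le> e * (1 + norm x)"
    using assms(1) by (simp add: near_def)
  moreover have "norm (t *\<^sub>R displacement S \<alpha> \<beta> x - w)
      \<le> norm (t *\<^sub>R displacement S \<alpha> \<beta> x - v) + norm (v - w)"
    using norm_triangle_ineq[of "t *\<^sub>R displacement S \<alpha> \<beta> x - v" "v - w"] by simp
  ultimately show "norm (t *\<^sub>R displacement S \<alpha> \<beta> x - w) \<le> (e + d) * (1 + norm x)"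
    using assms(2) by (simp add: algebra_simps)
qed

lemma near_mono:
  assumes "near \<alpha> \<beta> t e v" "e \<le> e'"
  shows "near \<alpha> \<beta> t e' v"
  using near_perturb[OF assms(1), of v "e' - e"] assms(2) by simp

lemma near_scale:
  assumes "near \<alpha> \<beta> t e v" "0 \<le> l"
  shows "near \<alpha> \<beta> (l * t) (l * e) (l *\<^sub>R v)"
  unfolding near_def
proof
  fix x :: "real^'n"
  have "norm ((l * t) *\<^sub>R displacement S \<alpha> \<beta> x - l *\<^sub>R v)
      = l * norm (t *\<^sub>R displacement S \<alpha> \<beta> x - v)"
    using assms(2) by (simp flip: scaleR_scaleR scaleR_diff_right)
  then show "norm ((l * t) *\<^sub>R displacement S \<alpha> \<beta> x - l *\<^sub>R v) \<le> l * e * (1 + norm x)"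
    using assms by (simp add: near_def mult.assoc mult_left_mono)
qed

lemma near_word_map:
  assumes "near \<alpha> \<beta> t e v" "w \<in> W"
  shows "norm (t *\<^sub>R displacement S \<alpha> \<beta> (word_map S w x) - v) \<le> e * distortion * (1 + norm x)"
proof -
  have "0 \<le> 2 * attractor_bound * norm x"
    using attractor_bound(1) by simp
  then have "1 + norm (word_map S w x) \<le> distortion * (1 + norm x)"
    using norm_word_map_le[OF assms(2), of x] by (simp add: algebra_simps)
  then have "e * (1 + norm (word_map S w x)) \<le> e * (distortion * (1 + norm x))"
    using near_nonneg[OF assms(1)] by (rule mult_left_mono)
  then show ?thesis
    using assms(1) unfolding near_def mult.assoc by (meson order_trans)
qed

text \<open>The magnification is absorbed into the scale \<open>t * ratio \<gamma>\<close>. The loss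
  in the error does not depend on \<open>\<gamma>\<close>, so \<open>\<gamma>\<close> may be chosen
  after the error.\<close>

lemma near_append_right:
  assumes "near \<alpha> \<beta> t e v" "\<alpha> \<in> W" "\<gamma> \<in> W"
  shows "near (\<alpha> @ \<gamma>) (\<beta> @ \<gamma>) (t * ratio \<gamma>) (e * distortion) (transpose (rot \<gamma>) *v v)"
  unfolding near_def
proof
  fix x :: "real^'n"
  have "(t * ratio \<gamma>) *\<^sub>R displacement S (\<alpha> @ \<gamma>) (\<beta> @ \<gamma>) x - transpose (rot \<gamma>) *v v
      = transpose (rot \<gamma>) *v (t *\<^sub>R displacement S \<alpha> \<beta> (word_map S \<gamma> x) - v)"
    using ratio_pos[OF assms(3)]
    by (simp add: displacement_append_right[OF assms(2,3)] matrix_vector_mult_diff_distrib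
        matrix_vector_mult_scaleR)
  then show "norm ((t * ratio \<gamma>) *\<^sub>R displacement S (\<alpha> @ \<gamma>) (\<beta> @ \<gamma>) x - transpose (rot \<gamma>) *v v)
      \<le> e * distortion * (1 + norm x)"
    using near_word_map[OF assms(1,3)] orthogonal_rot[OF assms(3)]
    by (simp add: norm_orthogonal_matrix_vector)
qed

text \<open>The outer displacement is magnified by \<open>1 / ratio \<alpha>\<close>. Prescribing it
  at scale \<open>s / ratio \<alpha>\<close> therefore brings both summands to the common scale
  \<open>s\<close>.\<close>

lemma near_append_left:
  assumes "near \<alpha> \<beta> s e v" "near \<alpha>' \<beta>' (s / ratio \<alpha>) e' w" "\<alpha> \<in> W" "\<alpha>' \<in> W" "\<beta> \<in> W"
  shows "near (\<alpha>' @ \<alpha>) (\<beta>' @ \<beta>) s (e + e' * distortion) (v + transpose (rot \<alpha>) *v w)"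
  unfolding near_def
proof
  fix x :: "real^'n"
  let ?T = "transpose (rot \<alpha>)"
  have "s *\<^sub>R displacement S (\<alpha>' @ \<alpha>) (\<beta>' @ \<beta>) x - (v + ?T *v w)
      = (s *\<^sub>R displacement S \<alpha> \<beta> x - v)
        + ?T *v ((s / ratio \<alpha>) *\<^sub>R displacement S \<alpha>' \<beta>' (word_map S \<beta> x) - w)"
    by (simp add: displacement_append_left[OF assms(3-5)] matrix_vector_mult_diff_distrib
        matrix_vector_mult_scaleR scaleR_add_right)
  also have "norm \<dots> \<le> norm (s *\<^sub>R displacement S \<alpha> \<beta> x - v)
      + norm ((s / ratio \<alpha>) *\<^sub>R displacement S \<alpha>' \<beta>' (word_map S \<beta> x) - w)"
    by (rule order_trans[OF norm_triangle_ineq])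
      (simp add: norm_orthogonal_matrix_vector orthogonal_rot[OF assms(3)])
  also have "\<dots> \<le> e * (1 + norm x) + e' * distortion * (1 + norm x)"
    using assms(1) near_word_map[OF assms(2,5)] by (intro add_mono) (auto simp: near_def)
  finally show "norm (s *\<^sub>R displacement S (\<alpha>' @ \<alpha>) (\<beta>' @ \<beta>) x - (v + ?T *v w))
      \<le> (e + e' * distortion) * (1 + norm x)"
    by (simp add: distrib_right)
qed

text \<open>The error is known at the preimage \<open>y\<close> of \<open>x\<close>. The lower bound
  on \<open>t\<close> keeps the displacement at \<open>y\<close> below half of
  \<open>1 + norm y\<close>, so \<open>1 + norm y\<close> is at most twice
  \<open>1 + norm x\<close>; hence the factor 2.\<close>

lemma near_swap:
  assumes "near \<alpha> \<beta> t e v" "\<alpha> \<in> W" "\<beta> \<in> W" "0 < t" "2 * (norm v + e) \<le> t"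
  shows "near \<beta> \<alpha> t (2 * e) (- v)"
  unfolding near_def
proof
  fix x :: "real^'n"
  obtain y where y: "y + displacement S \<alpha> \<beta> y = x"
    "displacement S \<beta> \<alpha> x = - displacement S \<alpha> \<beta> y"
    using displacement_swap[OF assms(2,3)] .
  have near_y: "norm (t *\<^sub>R displacement S \<alpha> \<beta> y - v) \<le> e * (1 + norm y)"
    using assms(1) by (simp add: near_def)
  have "t * norm (displacement S \<alpha> \<beta> y) \<le> norm v + e * (1 + norm y)"
    using near_y norm_triangle_sub[of "t *\<^sub>R displacement S \<alpha> \<beta> y" v] assms(4) by simp
  also have "\<dots> \<le> (norm v + e) * (1 + norm y)"
    by (simp add: algebra_simps)
  also have "\<dots> \<le> t / 2 * (1 + norm y)"
    using assms(5) by (intro mult_right_mono) auto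
  finally have "t * norm (displacement S \<alpha> \<beta> y) \<le> t * ((1 + norm y) / 2)"
    by simp
  then have "norm (displacement S \<alpha> \<beta> y) \<le> (1 + norm y) / 2"
    using assms(4) by (simp only: mult_le_cancel_left_pos)
  moreover have "y = x - displacement S \<alpha> \<beta> y"
    using y(1) by (simp add: algebra_simps)
  then have "norm y \<le> norm x + norm (displacement S \<alpha> \<beta> y)"
    using norm_triangle_ineq4[of x "displacement S \<alpha> \<beta> y"] by simp
  ultimately have "1 + norm y \<le> 2 * (1 + norm x)"
    by argo
  then have "e * (1 + norm y) \<le> e * (2 * (1 + norm x))"
    using near_nonneg[OF assms(1)] by (rule mult_left_mono)
  also have "\<dots> = 2 * e * (1 + norm x)"
    by simp
  finally show "norm (t *\<^sub>R displacement S \<beta> \<alpha> x - (- v)) \<le> 2 * e * (1 + norm x)"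
    using near_y norm_minus_commute[of v "t *\<^sub>R displacement S \<alpha> \<beta> y"] by (simp add: y(2))
qed

section \<open>Closure properties of translation limits\<close>

lemma translation_limitI:
  assumes "\<And>e N. 0 < e \<Longrightarrow> \<exists>t>N. \<exists>\<alpha>\<in>words m. \<exists>\<beta>\<in>words m. near \<alpha> \<beta> t e v"
  shows "translation_limit v"
  using assms by (simp add: translation_limit_def)

lemma translation_limitE:
  assumes "translation_limit v" "0 < e"
  obtains t \<alpha> \<beta> where "N < t" "\<alpha> \<in> words m" "\<beta> \<in> words m" "near \<alpha> \<beta> t e v"
  using assms unfolding translation_limit_def by blast

lemma translation_limit_approx:
  assumes "\<And>e. 0 < e \<Longrightarrow> \<exists>w. translation_limit w \<and> norm (w - v) \<le> e"
  shows "translation_limit v"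
proof (rule translation_limitI)
  fix e N :: real
  assume "0 < e"
  then obtain w where w: "translation_limit w" "norm (w - v) \<le> e / 2"
    using assms[of "e / 2"] by auto
  obtain t \<alpha> \<beta> where "N < t" "\<alpha> \<in> words m" "\<beta> \<in> words m" "near \<alpha> \<beta> t (e / 2) w"
    using translation_limitE[OF w(1), of "e / 2" N] \<open>0 < e\<close> by auto
  then show "\<exists>t>N. \<exists>\<alpha>\<in>words m. \<exists>\<beta>\<in>words m. near \<alpha> \<beta> t e v"
    using near_perturb[OF _ w(2)] by fastforce
qed

lemma closed_translation_limit: "closed {v. translation_limit v}"
proof -
  have "translation_limit v" if v: "v \<in> closure {v. translation_limit v}" for v
  proof (rule translation_limit_approx)
    fix e :: real
    assume "0 < e"
    then obtain w where "translation_limit w" "dist w v < e"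
      using v unfolding closure_approachable by blast
    then show "\<exists>w. translation_limit w \<and> norm (w - v) \<le> e"
      by (auto simp: dist_norm)
  qed
  then have "closure {v. translation_limit v} \<subseteq> {v. translation_limit v}"
    by blast
  then show ?thesis
    by (simp only: closure_subset_eq)
qed

text \<open>For constructions whose target vector varies with the accuracy and the scale: a
  convergent subsequence of the targets supplies a single limit vector.\<close>

lemma translation_limit_compact:
  assumes "compact K"
    and near_K: "\<And>e N. 0 < e \<Longrightarrow> \<exists>v\<in>K. \<exists>t>N. \<exists>\<alpha>\<in>words m. \<exists>\<beta>\<in>words m. near \<alpha> \<beta> t e v"
  obtains v where "v \<in> K" "translation_limit v"
proof -
  have "\<exists>v\<in>K. \<exists>t>real k. \<exists>\<alpha>\<in>words m. \<exists>\<beta>\<in>words m. near \<alpha> \<beta> t (inverse (Suc k)) v" for k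
    using near_K[of "inverse (Suc k)" "real k"] by auto
  then obtain u where u: "\<And>k. u k \<in> K"
    "\<And>k. \<exists>t>real k. \<exists>\<alpha>\<in>words m. \<exists>\<beta>\<in>words m. near \<alpha> \<beta> t (inverse (Suc k)) (u k)"
    by metis
  obtain v r where v: "v \<in> K" "strict_mono r" "(u \<circ> r) \<longlonglongrightarrow> v"
    using assms(1) u(1) unfolding compact_def by metis
  have "translation_limit v"
  proof (rule translation_limitI)
    fix e N :: real
    assume "0 < e"
    then have "\<forall>\<^sub>F k in sequentially. dist ((u \<circ> r) k) v < e / 2"
      by (intro tendstoD[OF v(3)]) simp
    moreover have "\<forall>\<^sub>F k in sequentially. inverse (real (Suc k)) < e / 2"
      using \<open>0 < e\<close> by (intro order_tendstoD[OF LIMSEQ_inverse_real_of_nat]) simp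
    moreover have "\<forall>\<^sub>F k in sequentially. N < real k"
      using filterlim_real_sequentially by (auto simp: filterlim_at_top_dense)
    ultimately have "\<forall>\<^sub>F k in sequentially.
        dist ((u \<circ> r) k) v < e / 2 \<and> inverse (real (Suc k)) < e / 2 \<and> N < real k"
      by eventually_elim simp
    then obtain k where k: "dist ((u \<circ> r) k) v < e / 2" "inverse (real (Suc k)) < e / 2" "N < real k"
      using eventually_happens'[OF sequentially_bot] by blast
    obtain t \<alpha> \<beta> where t: "real (r k) < t" "\<alpha> \<in> words m" "\<beta> \<in> words m"
      "near \<alpha> \<beta> t (inverse (Suc (r k))) (u (r k))"
      using u(2) by blast
    have "k \<le> r k"
      by (rule seq_suble[OF v(2)])
    then have "inverse (real (Suc (r k))) \<le> inverse (real (Suc k))" "N < t"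
      using k(3) t(1) by (auto intro: le_imp_inverse_le)
    moreover have "near \<alpha> \<beta> t e v"
    proof (rule near_mono[OF near_perturb[OF t(4)]])
      show "norm (u (r k) - v) \<le> e / 2"
        using k(1) by (simp add: dist_norm)
      show "inverse (real (Suc (r k))) + e / 2 \<le> e"
        using calculation(1) k(2) by linarith
    qed
    ultimately show "\<exists>t>N. \<exists>\<alpha>\<in>words m. \<exists>\<beta>\<in>words m. near \<alpha> \<beta> t e v"
      using t(2,3) by blast
  qed
  then show thesis
    using that v(1) by blast
qed

lemma translation_limit_zero: "translation_limit 0"
proof (rule translation_limitI)
  fix e N :: real
  assume "0 < e"
  moreover have "[1] \<in> words m"
    using one_in_range by (simp add: words_def)
  moreover have "near [1] [1] (N + 1) e 0"
    unfolding near_def using \<open>0 < e\<close> displacement_self[of "[1]"] one_in_range by simp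
  ultimately show "\<exists>t>N. \<exists>\<alpha>\<in>words m. \<exists>\<beta>\<in>words m. near \<alpha> \<beta> t e 0"
    by (intro exI[of _ "N + 1"]) auto
qed

lemma translation_limit_scale:
  assumes "translation_limit v" "0 < l"
  shows "translation_limit (l *\<^sub>R v)"
proof (rule translation_limitI)
  fix e N :: real
  assume "0 < e"
  then obtain t \<alpha> \<beta> where t: "N / l < t" "\<alpha> \<in> words m" "\<beta> \<in> words m" "near \<alpha> \<beta> t (e / l) v"
    using translation_limitE[OF assms(1), of "e / l" "N / l"] assms(2) by auto
  have "near \<alpha> \<beta> (l * t) e (l *\<^sub>R v)" "N < l * t"
    using near_scale[OF t(4), of l] t(1) assms(2) by (simp_all add: field_simps)
  then show "\<exists>t>N. \<exists>\<alpha>\<in>words m. \<exists>\<beta>\<in>words m. near \<alpha> \<beta> t e (l *\<^sub>R v)"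
    using t(2,3) by blast
qed

lemma translation_limit_minus:
  assumes "translation_limit v"
  shows "translation_limit (- v)"
proof (rule translation_limitI)
  fix e N :: real
  assume "0 < e"
  then obtain t \<alpha> \<beta> where t: "max N (max 0 (2 * (norm v + e / 2))) < t"
    "\<alpha> \<in> words m" "\<beta> \<in> words m" "near \<alpha> \<beta> t (e / 2) v"
    using translation_limitE[OF assms, of "e / 2" "max N (max 0 (2 * (norm v + e / 2)))"] by auto
  have "near \<beta> \<alpha> t e (- v)"
    using near_swap[OF t(4)] t(1,2,3) by (simp add: words_iff)
  then show "\<exists>t>N. \<exists>\<alpha>\<in>words m. \<exists>\<beta>\<in>words m. near \<alpha> \<beta> t e (- v)"
    using t by auto
qed

lemma translation_limit_transpose_rot:
  assumes "translation_limit v" "\<gamma> \<in> W"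
  shows "translation_limit (transpose (rot \<gamma>) *v v)"
proof (rule translation_limitI)
  fix e N :: real
  assume "0 < e"
  have pos: "0 < distortion"
    using attractor_bound(1) by simp
  obtain t \<alpha> \<beta> where t: "N / ratio \<gamma> < t"
    "\<alpha> \<in> words m" "\<beta> \<in> words m" "near \<alpha> \<beta> t (e / distortion) v"
    using translation_limitE[OF assms(1), of "e / distortion"] \<open>0 < e\<close> pos by (metis divide_pos_pos)
  have "near (\<alpha> @ \<gamma>) (\<beta> @ \<gamma>) (t * ratio \<gamma>) e (transpose (rot \<gamma>) *v v)"
    using near_append_right[OF t(4) _ assms(2)] t(2) pos by (simp add: words_iff)
  moreover have "N < t * ratio \<gamma>"
    using t(1) ratio_pos[OF assms(2)] by (simp add: field_simps)
  ultimately show "\<exists>t>N. \<exists>\<alpha>\<in>words m. \<exists>\<beta>\<in>words m. near \<alpha> \<beta> t e (transpose (rot \<gamma>) *v v)"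
    using words_append[OF t(2) assms(2)] words_append[OF t(3) assms(2)] by blast
qed

section \<open>Powers of a word and inverse rotations\<close>

lemma power_word_in_W: "\<gamma> \<in> W \<Longrightarrow> concat (replicate k \<gamma>) \<in> W"
  by (induction k) auto

lemma ratio_power_word: "ratio (concat (replicate k \<gamma>)) = ratio \<gamma> ^ k"
  by (induction k) simp_all

lemma rot_power_word:
  "transpose (rot (concat (replicate k \<gamma>))) *v u = ((\<lambda>x. transpose (rot \<gamma>) *v x) ^^ k) u"
  by (induction k arbitrary: u)
    (simp_all add: word_matrix_append matrix_transpose_mul funpow_swap1 flip: matrix_vector_mul_assoc)

text \<open>Conjugation only gives transposed rotations. A positive power of the transpose nearly
  fixes \<open>rot \<gamma> *v v\<close>, and one of its factors cancels
  \<open>rot \<gamma>\<close>, so the remaining power applied to \<open>v\<close> approximates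
  \<open>rot \<gamma> *v v\<close>.\<close>

lemma translation_limit_rot:
  assumes "translation_limit v" "\<gamma> \<in> W"
  shows "translation_limit (rot \<gamma> *v v)"
proof (rule translation_limit_approx)
  fix e :: real
  assume "0 < e"
  let ?f = "\<lambda>x. transpose (rot \<gamma>) *v x"
  have orth: "orthogonal_matrix (rot \<gamma>)"
    by (rule orthogonal_rot[OF assms(2)])
  obtain n where n: "norm ((?f ^^ Suc n) (rot \<gamma> *v v) - rot \<gamma> *v v) \<le> e"
    using orthogonal_power_return[of "transpose (rot \<gamma>)" e] orth \<open>0 < e\<close> by auto
  have "(?f ^^ Suc n) (rot \<gamma> *v v) = (?f ^^ n) v"
    by (simp add: transpose_matrix_vector_cancel orth funpow_swap1)
  moreover have "translation_limit ((?f ^^ n) v)"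
    using translation_limit_transpose_rot[OF assms(1) power_word_in_W[OF assms(2)]]
    by (simp add: rot_power_word)
  ultimately show "\<exists>w. translation_limit w \<and> norm (w - rot \<gamma> *v v) \<le> e"
    using n by auto
qed

section \<open>Sums of translation limits\<close>

text \<open>The increment is the second displacement, blown up until it has the size \<open>\<delta> / t\<close>. Blowing up
  also rotates it; removing a bounded number of letters makes the rotation close to the identity,
  at the price of a factor bounded below independently of all choices.\<close>

lemma translation_limit_increment:
  assumes z: "translation_limit z" and w: "translation_limit w" and "0 < \<delta>" "0 < \<eta>"
  obtains l z' where "0 < l" "l \<le> \<delta>" "translation_limit z'" "norm (z' - z - l *\<^sub>R w) \<le> l * \<eta>"
proof -
  define A where "A = transpose (rot [1])"
  define r where "r = ratio [1]"
  have one: "[1] \<in> W"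
    using one_in_range by simp
  have r: "0 < r" "r < 1"
    using generator[OF one_in_range] by (simp_all add: r_def)
  have pos: "0 < \<eta> / (norm w + 1)"
    by (simp add: add_nonneg_pos assms)
  have orth_A: "orthogonal_matrix A"
    using orthogonal_rot[OF one] by (simp add: A_def)
  obtain N where N: "\<And>n. \<exists>q\<le>N. q \<le> n \<and>
      (\<forall>u. norm (((\<lambda>x. A *v x) ^^ (n - q)) u - u) \<le> \<eta> / (norm w + 1) * norm u)"
    using orthogonal_power_recurrence[OF orth_A pos] by blast
  \<comment> \<open>All admissible targets. The lower bound on \<open>l\<close>, fixed before the
    accuracy and the scale, keeps \<open>l\<close> positive when the targets pass to a
    limit.\<close>
  define K where "K = (\<lambda>(l, d). z + l *\<^sub>R (w + d)) ` ({\<delta> * r ^ Suc N..\<delta>} \<times> cball 0 \<eta>)"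
  have "compact K"
    unfolding K_def case_prod_beta
    by (intro compact_continuous_image continuous_intros compact_Times) auto
  moreover have "\<exists>v\<in>K. \<exists>t>M. \<exists>\<alpha>\<in>words m. \<exists>\<beta>\<in>words m. near \<alpha> \<beta> t e v"
    if e: "0 < e" for e M
  proof -
    have dist_pos: "0 < distortion"
      using attractor_bound(1) by simp
    \<comment> \<open>One factor \<open>distortion\<close> is lost in appending on the right and one
      in appending on the left, and \<open>l\<close> is at most \<open>\<delta>\<close>; the total
      contribution is then at most \<open>e / 2\<close>.\<close>
    define e2 where "e2 = e / (2 * \<delta> * distortion * distortion)"
    have "0 < e2"
      using e dist_pos assms by (simp add: e2_def)
    obtain s \<alpha> \<beta> where s: "max M 0 < s" "\<alpha> \<in> words m" "\<beta> \<in> words m" "near \<alpha> \<beta> s (e / 2) z"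
      by (rule translation_limitE[OF z half_gt_zero[OF e], of "max M 0"])
    have W: "\<alpha> \<in> W" "\<beta> \<in> W"
      using s(2,3) by (simp_all add: words_iff)
    define \<sigma> where "\<sigma> = s / ratio \<alpha>"
    have "0 < \<sigma>"
      using s(1) ratio_pos[OF W(1)] by (simp add: \<sigma>_def)
    \<comment> \<open>The target is rotated by \<open>rot \<alpha>\<close> in advance, since
      appending on the left applies the transpose. The bound on \<open>t\<close> makes the
      unmagnified displacement fine enough, so that \<open>small 0\<close> fails.\<close>
    obtain t \<alpha>' \<beta>' where t: "\<sigma> / \<delta> < t" "\<alpha>' \<in> words m" "\<beta>' \<in> words m"
      "near \<alpha>' \<beta>' t e2 (rot \<alpha> *v w)"
      by (rule translation_limitE[OF translation_limit_rot[OF w W(1)] \<open>0 < e2\<close>, of "\<sigma> / \<delta>"])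
    have W': "\<alpha>' \<in> W" "\<beta>' \<in> W"
      using t(2,3) by (simp_all add: words_iff)
    have "0 < \<sigma> / \<delta>"
      using \<open>0 < \<sigma>\<close> assms(3) by simp
    then have "0 < t"
      using t(1) by linarith
    obtain k where k: "r ^ k < \<sigma> / \<delta> / t"
      using real_arch_pow_inv[OF divide_pos_pos[OF \<open>0 < \<sigma> / \<delta>\<close> \<open>0 < t\<close>] r(2)] by blast
    define small where "small k \<longleftrightarrow> t * r ^ k < \<sigma> / \<delta>" for k
    have "small k" "\<not> small 0"
      using k t(1) \<open>0 < t\<close> unfolding small_def pos_less_divide_eq[OF \<open>0 < t\<close>]
      by (auto simp only: mult.commute[of t] power_0 mult_1_left not_less less_imp_le)
    \<comment> \<open>\<open>n\<close> is the last exponent before the scale drops below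
      \<open>\<sigma> / \<delta>\<close>, so the overshoot is at most one factor
      \<open>r\<close>.\<close>
    from ex_least_nat_less[of small, OF this]
    obtain n where n: "\<not> small n" "small (Suc n)"
      by blast
    obtain q where q: "q \<le> N" "q \<le> n"
      "\<And>u. norm (((\<lambda>x. A *v x) ^^ (n - q)) u - u) \<le> \<eta> / (norm w + 1) * norm u"
      using N[of n] by blast
    define \<gamma> where "\<gamma> = concat (replicate (n - q) [1::nat])"
    have \<gamma>: "\<gamma> \<in> W" "ratio \<gamma> = r ^ (n - q)"
      unfolding \<gamma>_def r_def by (rule power_word_in_W[OF one], rule ratio_power_word)
    define u where "u = transpose (rot \<gamma>) *v (rot \<alpha> *v w)"
    define t' where "t' = t * ratio \<gamma>"
    \<comment> \<open>Multiplying by \<open>l\<close> turns the scale \<open>t'\<close> into the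
      required \<open>\<sigma>\<close>, and the target \<open>u\<close> into the increment.\<close>
    define l where "l = \<sigma> / t'"
    have "0 < t'"
      using \<open>0 < t\<close> ratio_pos[OF \<gamma>(1)] by (simp add: t'_def)
    have "0 < l"
      using \<open>0 < \<sigma>\<close> \<open>0 < t'\<close> by (simp add: l_def)
    have "r ^ n \<le> r ^ (n - q)"
      using r by (intro power_decreasing) auto
    then have "t * r ^ n \<le> t'"
      using \<open>0 < t\<close> by (simp add: t'_def \<gamma>)
    then have "\<sigma> / \<delta> \<le> t'"
      using n(1) by (simp add: small_def)
    then have l_le: "l \<le> \<delta>"
      using \<open>0 < t'\<close> assms(3) by (simp add: l_def field_simps)
    \<comment> \<open>Dropping \<open>q\<close> letters costs at most \<open>r ^ N\<close>, and the
      overshoot one more \<open>r\<close>; this gives the lower bound on \<open>l\<close>.\<close>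
    have "t' * r ^ Suc N \<le> t' * r ^ Suc q"
      using r q(1) \<open>0 < t'\<close> by (intro mult_left_mono power_decreasing) auto
    also have "\<dots> = t * (r ^ (n - q) * r ^ Suc q)"
      by (simp add: t'_def \<gamma>)
    also have "\<dots> = t * r ^ Suc n"
      using q(2) by (simp flip: power_add)
    finally have "t' * r ^ Suc N \<le> \<sigma> / \<delta>"
      using n(2) by (simp add: small_def)
    then have l_ge: "\<delta> * r ^ Suc N \<le> l"
      using \<open>0 < t'\<close> assms(3) by (simp add: l_def field_simps)
    have "near (\<alpha>' @ \<gamma>) (\<beta>' @ \<gamma>) t' (e2 * distortion) u"
      unfolding t'_def u_def by (rule near_append_right[OF t(4) W'(1) \<gamma>(1)])
    then have near_l: "near (\<alpha>' @ \<gamma>) (\<beta>' @ \<gamma>) (l * t') (l * (e2 * distortion)) (l *\<^sub>R u)"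
      using \<open>0 < l\<close> by (intro near_scale) auto
    have l_t: "l * t' = s / ratio \<alpha>"
      using \<open>0 < t'\<close> by (simp add: l_def \<sigma>_def)
    have "\<alpha>' @ \<gamma> \<in> W"
      using W' \<gamma>(1) by simp
    then have near_sum: "near ((\<alpha>' @ \<gamma>) @ \<alpha>) ((\<beta>' @ \<gamma>) @ \<beta>) s
        (e / 2 + l * (e2 * distortion) * distortion) (z + transpose (rot \<alpha>) *v (l *\<^sub>R u))"
      by (rule near_append_left[OF s(4) near_l[unfolded l_t] W(1) _ W(2)])
    have "l * (e2 * distortion) * distortion \<le> \<delta> * (e2 * distortion) * distortion"
      using l_le dist_pos \<open>0 < e2\<close> by (intro mult_right_mono) auto
    also have "\<dots> = e / 2"
    proof -
      have "\<delta> * (e / (2 * \<delta> * D * D) * D) * D = e / 2" if "0 < D" for D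
        using that assms(3) by (simp add: field_simps)
      from this[OF dist_pos] show ?thesis
        unfolding e2_def .
    qed
    finally have "near ((\<alpha>' @ \<gamma>) @ \<alpha>) ((\<beta>' @ \<gamma>) @ \<beta>) s e (z + transpose (rot \<alpha>) *v (l *\<^sub>R u))"
      by (intro near_mono[OF near_sum]) simp
    \<comment> \<open>\<open>d\<close> is the rotation error that remains once
      \<open>rot \<alpha>\<close> and its transpose have acted around the nearly trivial rotation of
      \<open>\<gamma>\<close>.\<close>
    moreover define d where "d = transpose (rot \<alpha>) *v u - w"
    have "z + transpose (rot \<alpha>) *v (l *\<^sub>R u) = z + l *\<^sub>R (w + d)"
      by (simp add: d_def matrix_vector_mult_scaleR)
    moreover have "norm d \<le> \<eta>"
    proof -
      have "norm d = norm (transpose (rot \<gamma>) *v (rot \<alpha> *v w) - rot \<alpha> *v w)"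
        unfolding d_def u_def by (rule matrix_sandwich_cancel_norm[OF orthogonal_rot[OF W(1)]])
      also have "\<dots> \<le> \<eta> / (norm w + 1) * norm (rot \<alpha> *v w)"
        using q(3)[of "rot \<alpha> *v w"] unfolding \<gamma>_def rot_power_word A_def .
      also have "\<dots> \<le> \<eta> / (norm w + 1) * (norm w + 1)"
        using pos by (intro mult_left_mono)
          (auto simp: norm_orthogonal_matrix_vector[OF orthogonal_rot[OF W(1)]])
      also have "\<dots> = \<eta>"
        using norm_ge_zero[of w] by (simp del: norm_ge_zero)
      finally show ?thesis .
    qed
    then have "z + l *\<^sub>R (w + d) \<in> K"
      unfolding K_def using l_le l_ge by (intro image_eqI[of _ _ "(l, d)"]) auto
    moreover have "(\<alpha>' @ \<gamma>) @ \<alpha> \<in> words m" "(\<beta>' @ \<gamma>) @ \<beta> \<in> words m"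
      using t(2,3) \<gamma>(1) W by (auto simp: words_iff)
    ultimately show ?thesis
      using s(1) by (intro bexI[of _ "z + l *\<^sub>R (w + d)"] exI[of _ s]) auto
  qed
  ultimately obtain z' where "z' \<in> K" "translation_limit z'"
    using translation_limit_compact[of K] by blast
  then obtain l d where "z' = z + l *\<^sub>R (w + d)" "\<delta> * r ^ Suc N \<le> l" "l \<le> \<delta>" "norm d \<le> \<eta>"
    by (auto simp: K_def)
  moreover from this have "0 < l"
    using r assms(3) by (meson less_le_trans mult_pos_pos zero_less_power)
  moreover have "z' - z - l *\<^sub>R w = l *\<^sub>R d"
    using calculation(1) by (simp add: algebra_simps)
  ultimately show thesis
    using that[of l z'] \<open>translation_limit z'\<close> by (simp add: mult_left_mono)
qed

text \<open>Instead of counting increments, consider a translation limit that has advanced a maximal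
  fraction \<open>l\<close> of the way along \<open>w\<close>. The permitted error is proportional
  to \<open>l\<close>, so errors add up to at most \<open>\<eta>\<close>, and any \<open>l\<close>
  below 1 could be increased.\<close>

lemma translation_limit_add:
  assumes v: "translation_limit v" and w: "translation_limit w"
  shows "translation_limit (v + w)"
proof (rule translation_limit_approx)
  fix \<eta> :: real
  assume "0 < \<eta>"
  \<comment> \<open>The ball makes the set compact. Its radius is the largest distance from
    \<open>v\<close> compatible with the error condition for \<open>l\<close> up to 1.\<close>
  define K where "K = ({0..1::real} \<times> (cball v (norm w + \<eta>) \<inter> {z. translation_limit z}))
    \<inter> {p. norm (snd p - v - fst p *\<^sub>R w) \<le> fst p * \<eta>}"
  have "closed {p :: real \<times> (real^'n). norm (snd p - v - fst p *\<^sub>R w) \<le> fst p * \<eta>}"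
    by (intro closed_Collect_le continuous_intros)
  then have "compact K"
    unfolding K_def
    by (intro compact_Int_closed compact_Times closed_translation_limit) auto
  moreover have "(0, v) \<in> K"
    using \<open>0 < \<eta>\<close> v by (simp add: K_def add_nonneg_nonneg)
  ultimately obtain p where p: "p \<in> K" "\<And>p'. p' \<in> K \<Longrightarrow> fst p' \<le> fst p"
    using continuous_attains_sup[of K fst] continuous_on_fst[OF continuous_on_id[of K]] by blast
  define l z where "l = fst p" and "z = snd p"
  have lz: "0 \<le> l" "l \<le> 1" "translation_limit z" "norm (z - v - l *\<^sub>R w) \<le> l * \<eta>"
    using p(1) by (auto simp: K_def l_def z_def)
  have "l = 1"
  proof (rule ccontr)
    assume "l \<noteq> 1"
    then obtain l' z' where l': "0 < l'" "l' \<le> 1 - l" "translation_limit z'"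
      "norm (z' - z - l' *\<^sub>R w) \<le> l' * \<eta>"
      using translation_limit_increment[OF lz(3) w, of "1 - l" \<eta>] lz(2) \<open>0 < \<eta>\<close> by auto
    have "z' - v - (l + l') *\<^sub>R w = (z' - z - l' *\<^sub>R w) + (z - v - l *\<^sub>R w)"
      by (simp add: algebra_simps)
    then have sum: "norm (z' - v - (l + l') *\<^sub>R w) \<le> (l + l') * \<eta>"
      using norm_triangle_ineq[of "z' - z - l' *\<^sub>R w" "z - v - l *\<^sub>R w"] l'(4) lz(4)
      by (simp add: algebra_simps)
    have "norm (z' - v) \<le> (l + l') * \<eta> + norm ((l + l') *\<^sub>R w)"
      using sum norm_triangle_sub[of "z' - v" "(l + l') *\<^sub>R w"] by linarith
    also have "\<dots> = (l + l') * (norm w + \<eta>)"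
      using lz(1) l'(1) by (simp add: distrib_left)
    also have "\<dots> \<le> 1 * (norm w + \<eta>)"
      using l'(2) \<open>0 < \<eta>\<close> by (intro mult_right_mono) auto
    finally have "(l + l', z') \<in> K"
      using lz l' sum by (simp add: K_def dist_norm norm_minus_commute)
    then show False
      using p(2)[of "(l + l', z')"] l'(1) by (simp add: l_def)
  qed
  then have "norm (z - (v + w)) \<le> \<eta>"
    using lz(4) by (simp add: algebra_simps)
  then show "\<exists>z. translation_limit z \<and> norm (z - (v + w)) \<le> \<eta>"
    using lz(3) by blast
qed

lemma subspace_translation_limit: "subspace {v. translation_limit v}"
proof (rule subspaceI)
  fix l :: real and v
  assume "v \<in> {v. translation_limit v}"
  then have v: "translation_limit v"
    by simp
  consider "l = 0" | "0 < l" | "0 < - l"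
    by linarith
  then show "l *\<^sub>R v \<in> {v. translation_limit v}"
  proof cases
    case 3
    then show ?thesis
      using translation_limit_scale[OF translation_limit_minus[OF v] 3] by simp
  qed (use v translation_limit_zero translation_limit_scale in auto)
qed (auto intro: translation_limit_zero translation_limit_add)

text \<open>For fixed \<open>v\<close>, the matrices taking \<open>v\<close> to a translation limit
  form a closed set, so invariance passes from words to the closure.\<close>

lemma translation_limit_rotation_group:
  assumes "translation_limit v" "A \<in> rotation_group m Q"
  shows "translation_limit (A *v v)"
proof -
  have "closed ((\<lambda>A. A *v v) -` {v. translation_limit v})"
    by (intro closed_vimage closed_translation_limit linear_continuous_on)
      (auto simp: linear_conv_bounded_linear[symmetric] algebra_simps
        simp flip: scaleR_matrix_vector_assoc intro!: linearI)
  moreover have "word_matrix Q ` words m \<subseteq> (\<lambda>A. A *v v) -` {v. translation_limit v}"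
    using translation_limit_rot[OF assms(1)] by (auto simp: words_iff)
  ultimately have "closure (word_matrix Q ` words m) \<subseteq> (\<lambda>A. A *v v) -` {v. translation_limit v}"
    by (rule closure_minimal[rotated])
  moreover have "A \<in> closure (word_matrix Q ` words m)"
    using assms(2) closure_of_subtopology_subset by (force simp: rotation_group_def)
  ultimately show ?thesis
    by blast
qed

section \<open>Overlapping directions\<close>

lemma bdd_above_displacement:
  assumes "\<alpha> \<in> W" "\<beta> \<in> W"
  shows "bdd_above ((\<lambda>x. norm (displacement S \<alpha> \<beta> x)) ` cbox 0 1)"
  by (intro bounded_imp_bdd_above compact_imp_bounded compact_continuous_image
      continuous_on_norm continuous_on_displacement[OF assms] compact_cbox)

lemma norm_displacement_le_cube_sup_norm:
  assumes "\<alpha> \<in> W" "\<beta> \<in> W" "x \<in> cbox 0 1"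
  shows "norm (displacement S \<alpha> \<beta> x) \<le> cube_sup_norm (displacement S \<alpha> \<beta>)"
  unfolding cube_sup_norm_def
  using assms(3) bdd_above_displacement[OF assms(1,2)] by (rule cSUP_upper)

text \<open>An affine map is determined by its values at 0 and at the standard basis vectors, which
  are vertices of the cube. Thus the sup norm on the cube controls values at points outside it, such
  as those of the attractor.\<close>

lemma norm_displacement_le:
  assumes "\<alpha> \<in> W" "\<beta> \<in> W"
  shows "norm (displacement S \<alpha> \<beta> x)
    \<le> (1 + 2 * (\<Sum>i\<in>UNIV. \<bar>x $ i\<bar>)) * cube_sup_norm (displacement S \<alpha> \<beta>)"
proof -
  define M where "M = displacement_matrix \<alpha> \<beta>"
  define s where "s = cube_sup_norm (displacement S \<alpha> \<beta>)"
  let ?d = "displacement S \<alpha> \<beta>"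
  have d0: "norm (?d 0) \<le> s"
    unfolding s_def by (rule norm_displacement_le_cube_sup_norm[OF assms]) (simp add: mem_box_cart)
  have col: "norm (column i M) \<le> 2 * s" for i
  proof -
    have "norm (?d (axis i 1)) \<le> s"
      unfolding s_def
      by (rule norm_displacement_le_cube_sup_norm[OF assms]) (simp add: mem_box_cart axis_def)
    moreover have "column i M = ?d (axis i 1) - ?d 0"
      using displacement_affine[OF assms, of "axis i 1" 0]
      by (simp add: M_def matrix_vector_mult_basis)
    ultimately show ?thesis
      using norm_triangle_ineq4[of "?d (axis i 1)" "?d 0"] d0 by simp
  qed
  have "norm (M *v x) \<le> (\<Sum>i\<in>UNIV. \<bar>x $ i\<bar> * norm (column i M))"
    unfolding matrix_mult_sum scalar_mult_eq_scaleR by (rule order_trans[OF norm_sum]) simp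
  also have "\<dots> \<le> (\<Sum>i\<in>UNIV. \<bar>x $ i\<bar> * (2 * s))"
    by (intro sum_mono mult_left_mono col) simp
  also have "\<dots> = 2 * (\<Sum>i\<in>UNIV. \<bar>x $ i\<bar>) * s"
    by (simp add: sum_distrib_left sum_distrib_right mult_ac)
  finally have "norm (M *v x) \<le> 2 * (\<Sum>i\<in>UNIV. \<bar>x $ i\<bar>) * s" .
  moreover have "?d x = ?d 0 + M *v x"
    using displacement_affine[OF assms, of x 0] by (simp add: M_def)
  ultimately have "norm (?d x) \<le> s + 2 * (\<Sum>i\<in>UNIV. \<bar>x $ i\<bar>) * s"
    using norm_triangle_ineq[of "?d 0" "M *v x"] d0 by simp
  then show ?thesis
    by (simp add: s_def distrib_right)
qed

text \<open>Subtracting the estimates at 0 and at a unit vector eliminates \<open>v\<close>; their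
  errors \<open>e\<close> and \<open>2 * e\<close> give the constant 3.\<close>

lemma near_displacement_matrix:
  assumes "near \<alpha> \<beta> t e v" "\<alpha> \<in> W" "\<beta> \<in> W" "0 < t"
  shows "t * norm (displacement_matrix \<alpha> \<beta> *v x) \<le> 3 * e * norm x"
proof (cases "x = 0")
  case False
  define u where "u = x /\<^sub>R norm x"
  have u: "norm u = 1" "x = norm x *\<^sub>R u"
    using False by (simp_all add: u_def)
  let ?d = "displacement S \<alpha> \<beta>"
  have "t *\<^sub>R (displacement_matrix \<alpha> \<beta> *v u) = (t *\<^sub>R ?d u - v) - (t *\<^sub>R ?d 0 - v)"
    using displacement_affine[OF assms(2,3), of u 0] by (simp add: algebra_simps)
  moreover have "norm (t *\<^sub>R ?d u - v) \<le> e * (1 + norm u)" "norm (t *\<^sub>R ?d 0 - v) \<le> e * (1 + norm (0 :: real^'n))"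
    using assms(1) unfolding near_def by blast+
  ultimately have "norm (t *\<^sub>R (displacement_matrix \<alpha> \<beta> *v u)) \<le> 3 * e"
    using norm_triangle_ineq4[of "t *\<^sub>R ?d u - v" "t *\<^sub>R ?d 0 - v"] u(1) by simp
  then have "norm x * (t * norm (displacement_matrix \<alpha> \<beta> *v u)) \<le> norm x * (3 * e)"
    using assms(4) by (intro mult_left_mono) auto
  moreover have "norm (displacement_matrix \<alpha> \<beta> *v x) = norm x * norm (displacement_matrix \<alpha> \<beta> *v u)"
    by (subst u(2)) (simp add: matrix_vector_mult_scaleR)
  ultimately show ?thesis
    by (simp add: mult_ac)
qed simp

text \<open>A nonzero displacement at 0 rules out both equal words and the identity map, and
  convergence in the product topology is pointwise convergence.\<close>

lemma not_weak_separationI: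
  fixes \<alpha> \<beta> :: "nat \<Rightarrow> nat list"
  assumes words: "\<And>k. \<alpha> k \<in> words m" "\<And>k. \<beta> k \<in> words m"
    and nonzero: "\<And>k. displacement S (\<alpha> k) (\<beta> k) 0 \<noteq> 0"
    and lim: "\<And>x. (\<lambda>k. displacement S (\<alpha> k) (\<beta> k) x) \<longlonglongrightarrow> 0"
  shows "\<not> weak_separation m S"
proof -
  define f where "f k = inv (word_map S (\<alpha> k)) \<circ> word_map S (\<beta> k)" for k
  have W: "\<alpha> k \<in> W" "\<beta> k \<in> W" for k
    using words[of k] by (simp_all add: words_iff)
  have f_eq: "f k x = x + displacement S (\<alpha> k) (\<beta> k) x" for k x
    by (simp add: f_def displacement_def)
  have f_nbr: "f k \<in> neighbour_maps m S - {id}" for k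
  proof -
    have "\<alpha> k \<noteq> \<beta> k"
      using nonzero[of k] W(1)[of k] displacement_self by metis
    then have "f k \<in> neighbour_maps m S"
      using words unfolding neighbour_maps_def f_def by blast
    moreover have "f k 0 \<noteq> id 0"
      using nonzero[of k] by (simp add: f_eq)
    then have "f k \<noteq> id"
      by metis
    ultimately show ?thesis
      by simp
  qed
  have f_sim: "f k \<in> similitudes" for k
  proof -
    let ?c = "ratio (\<beta> k) / ratio (\<alpha> k)" and ?R = "transpose (rot (\<alpha> k)) ** rot (\<beta> k)"
    have "f k x = ?c *\<^sub>R (?R *v x) + displacement S (\<alpha> k) (\<beta> k) 0" for x
      unfolding f_eq using displacement_affine[OF W(1)[of k] W(2)[of k], of x 0]
      by (simp add: displacement_matrix_def matrix_vector_mult_diff_rdistrib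
          flip: scaleR_matrix_vector_assoc)
    moreover have "0 < ?c"
      using ratio_pos W by simp
    moreover have "orthogonal_matrix ?R"
      using orthogonal_rot W by (simp add: orthogonal_matrix_mul)
    ultimately show ?thesis
      unfolding similitudes_def by blast
  qed
  have "id \<in> similitudes"
    unfolding similitudes_def
    by (intro CollectI exI[of _ 1] exI[of _ "mat 1"] exI[of _ 0])
      (auto simp: orthogonal_matrix_id fun_eq_iff)
  have "limitin (product_topology (\<lambda>_. euclidean) UNIV) f id sequentially"
    unfolding limitin_componentwise
    using tendsto_add[OF tendsto_const lim] by (auto simp: f_eq)
  then have "f \<longlonglongrightarrow> id"
    by (simp add: euclidean_product_topology)
  then have meets: "\<exists>k. f k \<in> U" if "open U" "id \<in> U" for U
    using eventually_happens'[OF sequentially_bot topological_tendstoD[OF _ that]] by blast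
  have "id \<in> top_of_set similitudes closure_of (neighbour_maps m S - {id})"
    unfolding in_closure_of
  proof (intro conjI allI impI)
    show "id \<in> topspace (top_of_set similitudes)"
      using \<open>id \<in> similitudes\<close> by simp
  next
    fix T :: "(real^'n \<Rightarrow> real^'n) set"
    assume "id \<in> T \<and> openin (top_of_set similitudes) T"
    then obtain U where "open U" "T = similitudes \<inter> U" "id \<in> U"
      by (auto simp: openin_open)
    then show "\<exists>g. g \<in> neighbour_maps m S - {id} \<and> g \<in> T"
      using meets f_nbr f_sim by blast
  qed
  then show ?thesis
    by (simp add: weak_separation_def)
qed

text \<open>Displacements close to \<open>v\<close> divided by \<open>t\<close> have a relatively
  negligible derivative, and normalising cancels \<open>t\<close>. Hence any point of the attractor
  with radius 1 serves as data.\<close>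

lemma overlapping_directionI:
  assumes v: "translation_limit v" and "norm v = 1"
  shows "overlapping_direction m S F v"
proof -
  obtain a where a: "a \<in> F"
    using attractor_facts(2) by blast
  \<comment> \<open>On the ball of radius 1 about \<open>a\<close>, \<open>1 + norm x\<close> is at
    most \<open>2 + norm a\<close>; adding the 3 from the derivative bound gives \<open>C\<close>.
    Then \<open>e k * C \<le> 1\<close> yields the derivative condition.\<close>
  define C where "C = 5 + norm a"
  define e where "e k = inverse (real (Suc k)) / C" for k
  have C: "5 \<le> C"
    by (simp add: C_def)
  have e: "0 < e k" "e k * C \<le> 1" "e k \<le> 1 / 5" for k
  proof -
    show pos: "0 < e k"
      using C by (simp add: e_def)
    have "e k * C = inverse (real (Suc k))"
      using C by (simp add: e_def)
    then show le: "e k * C \<le> 1"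
      by (simp add: inverse_le_1_iff)
    show "e k \<le> 1 / 5"
      using mult_left_mono[OF C less_imp_le[OF pos]] le by simp
  qed
  have "\<exists>t \<alpha> \<beta>. real (Suc k) < t \<and> \<alpha> \<in> words m \<and> \<beta> \<in> words m \<and> near \<alpha> \<beta> t (e k) v" for k
    by (rule translation_limitE[OF v e(1)[of k], of "real (Suc k)"]) blast
  then obtain t \<alpha> \<beta> where t: "\<And>k. real (Suc k) < t k"
    and words: "\<And>k. \<alpha> k \<in> words m" "\<And>k. \<beta> k \<in> words m"
    and near: "\<And>k. near (\<alpha> k) (\<beta> k) (t k) (e k) v"
    by metis
  have W: "\<alpha> k \<in> W" "\<beta> k \<in> W" for k
    using words[of k] by (simp_all add: words_iff)
  have t_pos: "0 < t k" for k
    using t[of k] by (rule le_less_trans[rotated]) simp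
  define \<Phi> where "\<Phi> k = displacement S (\<alpha> k) (\<beta> k)" for k
  have bound: "norm (t k *\<^sub>R \<Phi> k x - v) \<le> e k * (1 + norm x)" for k x
    using near[of k] by (simp add: near_def \<Phi>_def)
  have lower: "1 - e k * (1 + norm x) \<le> t k * norm (\<Phi> k x)" for k x
    using norm_triangle_ineq3[of "t k *\<^sub>R \<Phi> k x" v] bound[of k x] t_pos[of k] assms(2) by simp
  have upper: "norm (\<Phi> k x) \<le> (2 + norm x) * inverse (real (Suc k))" for k x
  proof -
    have "t k * norm (\<Phi> k x) \<le> 1 + e k * (1 + norm x)"
      using norm_triangle_sub[of "t k *\<^sub>R \<Phi> k x" v] bound[of k x] t_pos[of k] assms(2) by simp
    also have "e k * (1 + norm x) \<le> 1 * (1 + norm x)"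
      using e(3)[of k] by (intro mult_right_mono) auto
    finally have "norm (\<Phi> k x) \<le> (2 + norm x) * inverse (t k)"
      using t_pos[of k] by (simp add: field_simps)
    also have "\<dots> \<le> (2 + norm x) * inverse (real (Suc k))"
      using t[of k] by (intro mult_left_mono le_imp_inverse_le) auto
    finally show ?thesis .
  qed
  have \<Phi>_lim: "(\<lambda>k. \<Phi> k x) \<longlonglongrightarrow> 0" for x
    by (rule Lim_null_comparison[OF always_eventually[OF allI[OF upper]]])
      (intro tendsto_mult_right_zero LIMSEQ_inverse_real_of_nat)
  have \<Phi>_nonzero: "\<Phi> k 0 \<noteq> 0" for k
    using lower[of k 0] e(3)[of k] by auto
  have not_wsp: "\<not> weak_separation m S"
    by (rule not_weak_separationI[OF words, OF \<Phi>_nonzero[unfolded \<Phi>_def] \<Phi>_lim[unfolded \<Phi>_def]])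
  have sup_pos: "0 < cube_sup_norm (\<Phi> k)" for k
  proof -
    have "norm (\<Phi> k 0) \<le> cube_sup_norm (\<Phi> k)"
      unfolding \<Phi>_def by (rule norm_displacement_le_cube_sup_norm[OF W]) (simp add: mem_box_cart)
    then show ?thesis
      using \<Phi>_nonzero[of k] by (meson less_le_trans zero_less_norm_iff)
  qed
  have sup_lim: "(\<lambda>k. cube_sup_norm (\<Phi> k)) \<longlonglongrightarrow> 0"
  proof -
    obtain B where B: "\<And>x :: real^'n. x \<in> cbox 0 1 \<Longrightarrow> norm x \<le> B"
      using bounded_cbox[of "0 :: real^'n" 1] unfolding bounded_iff by blast
    have "cube_sup_norm (\<Phi> k) \<le> (2 + B) * inverse (real (Suc k))" for k
      unfolding cube_sup_norm_def
    proof (rule cSUP_least)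
      show "cbox 0 (1 :: real^'n) \<noteq> {}"
        by (simp add: interval_ne_empty_cart)
      fix x :: "real^'n"
      assume "x \<in> cbox 0 1"
      then have "(2 + norm x) * inverse (real (Suc k)) \<le> (2 + B) * inverse (real (Suc k))"
        using B by (intro mult_right_mono) auto
      then show "norm (\<Phi> k x) \<le> (2 + B) * inverse (real (Suc k))"
        using upper[of k x] by linarith
    qed
    then have "norm (cube_sup_norm (\<Phi> k)) \<le> (2 + B) * inverse (real (Suc k))" for k
      using sup_pos[of k] by simp
    then have "\<forall>\<^sub>F k in sequentially. norm (cube_sup_norm (\<Phi> k)) \<le> (2 + B) * inverse (real (Suc k))"
      by (intro always_eventually allI)
    then show ?thesis
      by (rule Lim_null_comparison) (intro tendsto_mult_right_zero LIMSEQ_inverse_real_of_nat)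
  qed
  have "\<exists>p. is_arg_min (\<lambda>x. norm (\<Phi> k x)) (\<lambda>x. x \<in> cball a 1) p" for k
  proof -
    have "continuous_on (cball a 1) (\<lambda>x. norm (\<Phi> k x))"
      unfolding \<Phi>_def by (intro continuous_on_norm continuous_on_displacement W)
    then obtain p where "p \<in> cball a 1" "\<forall>y\<in>cball a 1. norm (\<Phi> k p) \<le> norm (\<Phi> k y)"
      using continuous_attains_inf[of "cball a 1" "\<lambda>x. norm (\<Phi> k x)"] by auto
    then show ?thesis
      unfolding is_arg_min_linorder by blast
  qed
  then obtain p where p: "\<And>k. is_arg_min (\<lambda>x. norm (\<Phi> k x)) (\<lambda>x. x \<in> cball a 1) (p k)"
    by metis
  have deriv: "1 * onorm (frechet_derivative (\<Phi> k) (at 0)) \<le> norm (\<Phi> k (p k))" for k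
  proof -
    have "onorm (frechet_derivative (\<Phi> k) (at 0)) \<le> 3 * e k / t k"
      unfolding \<Phi>_def frechet_derivative_displacement[OF W]
      using near_displacement_matrix[OF near W t_pos] t_pos
      by (intro onorm_le) (simp add: field_simps)
    also have "\<dots> \<le> norm (\<Phi> k (p k))"
    proof -
      have "dist a (p k) \<le> 1"
        using p[of k] by (simp add: is_arg_min_def)
      then have "norm (p k) \<le> 1 + norm a"
        using norm_triangle_sub[of "p k" a] by (simp add: dist_norm norm_minus_commute)
      then have "e k * (1 + norm (p k)) \<le> e k * (2 + norm a)"
        using e(1)[of k] by (intro mult_left_mono) auto
      then have "3 * e k \<le> t k * norm (\<Phi> k (p k))"
        using lower[of k "p k"] e(2)[of k] by (simp add: C_def algebra_simps)
      then show ?thesis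
        using t_pos[of k] by (simp add: field_simps)
    qed
    finally show ?thesis
      by simp
  qed
  have direction: "(\<lambda>k. \<Phi> (id k) a /\<^sub>R norm (\<Phi> (id k) a)) \<longlonglongrightarrow> v"
  proof -
    have "(\<lambda>k. t k *\<^sub>R \<Phi> k a - v) \<longlonglongrightarrow> 0"
    proof (rule Lim_null_comparison[OF always_eventually[OF allI[OF bound]]])
      have "(\<lambda>k. inverse (real (Suc k)) * (inverse C * (1 + norm a))) \<longlonglongrightarrow> 0"
        by (intro tendsto_mult_left_zero LIMSEQ_inverse_real_of_nat)
      then show "(\<lambda>k. e k * (1 + norm a)) \<longlonglongrightarrow> 0"
        by (simp add: e_def divide_inverse mult.assoc)
    qed
    then have "(\<lambda>k. t k *\<^sub>R \<Phi> k a) \<longlonglongrightarrow> v"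
      by (simp add: LIM_zero_iff)
    then have "(\<lambda>k. (t k *\<^sub>R \<Phi> k a) /\<^sub>R norm (t k *\<^sub>R \<Phi> k a)) \<longlonglongrightarrow> v /\<^sub>R norm v"
      using assms(2) by (intro tendsto_scaleR tendsto_inverse tendsto_norm) auto
    moreover have "(t k *\<^sub>R \<Phi> k a) /\<^sub>R norm (t k *\<^sub>R \<Phi> k a) = \<Phi> k a /\<^sub>R norm (\<Phi> k a)" for k
      using t_pos[of k] by simp
    ultimately show ?thesis
      by (simp only: assms(2) id_apply inverse_1 scaleR_one)
  qed
  show ?thesis
    unfolding overlapping_direction_def
    by (rule conjI[OF not_wsp], rule exI[of _ \<alpha>], rule exI[of _ \<beta>], rule exI[of _ \<Phi>],
        rule exI[of _ a], rule exI[of _ "1 :: real"], rule exI[of _ p], rule exI[of _ id],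
        intro conjI allI words sup_pos sup_lim a p deriv strict_mono_id direction)
      (simp_all add: \<Phi>_def assms(2))
qed

section \<open>From overlapping directions to translation limits\<close>

text \<open>Zooming in at \<open>a\<close> leaves the derivative unchanged and enlarges the value there, so
  the displacement becomes a translation in the limit. The rotation picked up on the way is undone
  by zooming in along a power of the same word.\<close>

lemma overlapping_directionD:
  assumes "overlapping_direction m S F \<omega>"
  shows "translation_limit \<omega>"
proof (rule translation_limitI)
  fix e N :: real
  assume "0 < e"
  from assms[unfolded overlapping_direction_def] obtain \<alpha> \<beta> \<Phi> a \<rho> p r
    where words: "\<forall>k::nat. \<alpha> k \<in> words m \<and> \<beta> k \<in> words m"
    and \<Phi>: "\<forall>k. \<Phi> k = displacement S (\<alpha> k) (\<beta> k)"
    and sup_lim: "(\<lambda>k. cube_sup_norm (\<Phi> k)) \<longlonglongrightarrow> 0"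
    and a: "a \<in> F" and \<rho>: "0 < \<rho>"
    and p: "\<forall>k. is_arg_min (\<lambda>x. norm (\<Phi> k x)) (\<lambda>x. x \<in> cball a \<rho>) (p k)"
    and deriv: "\<forall>k. \<rho> * onorm (frechet_derivative (\<Phi> k) (at 0)) \<le> norm (\<Phi> k (p k))"
    and \<omega>: "\<omega> \<in> sphere 0 1" and r: "strict_mono r"
    and lim: "(\<lambda>k. \<Phi> (r k) a /\<^sub>R norm (\<Phi> (r k) a)) \<longlonglongrightarrow> \<omega>"
    by (elim conjE exE) (rule that)
  note words = words[THEN spec, THEN conjunct1] words[THEN spec, THEN conjunct2]
  note \<Phi> = \<Phi>[rule_format] and p = p[rule_format] and deriv = deriv[rule_format]
  have W: "\<alpha> k \<in> W" "\<beta> k \<in> W" for k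
    using words[of k] by (simp_all add: words_iff)
  define M where "M k = displacement_matrix (\<alpha> k) (\<beta> k)" for k
  \<comment> \<open>The minimum over the ball is at most the value at its centre \<open>a\<close>,
    so the derivative is controlled by the displacement at \<open>a\<close> itself.\<close>
  have deriv_le: "norm (M k *v x) \<le> norm (\<Phi> k a) / \<rho> * norm x" for k x
  proof -
    have "norm (\<Phi> k (p k)) \<le> norm (\<Phi> k a)"
      using p[of k] \<rho> by (simp add: is_arg_min_linorder)
    then have "\<rho> * onorm (\<lambda>x. M k *v x) \<le> norm (\<Phi> k a)"
      using deriv[of k] by (simp add: \<Phi> M_def frechet_derivative_displacement[OF W])
    then have "onorm (\<lambda>x. M k *v x) \<le> norm (\<Phi> k a) / \<rho>"
      using \<rho> by (simp add: field_simps)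
    then have "onorm (\<lambda>x. M k *v x) * norm x \<le> norm (\<Phi> k a) / \<rho> * norm x"
      by (rule mult_right_mono) simp
    then show ?thesis
      using onorm[OF matrix_vector_mul_bounded_linear[of "M k"], of x] by linarith
  qed
  define R where "R = 1 + 3 * attractor_bound"
  have R: "0 < R"
    using attractor_bound(1) by (simp add: R_def)
  \<comment> \<open>The length is chosen so that any address of \<open>a\<close> of this length
    makes the contribution of the derivative at most \<open>e / 3\<close>.\<close>
  obtain n where n: "\<And>w. w \<in> W \<Longrightarrow> length w = n \<Longrightarrow> ratio w < e * \<rho> / (3 * R)"
    using ratio_small[of "e * \<rho> / (3 * R)"] \<open>0 < e\<close> \<rho> R by auto
  obtain \<tau> a' where \<tau>: "\<tau> \<in> W" "length \<tau> = n" "a' \<in> F" "a = word_map S \<tau> a'"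
    using attractor_address[OF a] .
  have ratio_\<tau>: "ratio \<tau> * R / \<rho> \<le> e / 3"
    using n[OF \<tau>(1,2)] \<rho> R by (simp add: field_simps)
  obtain j where j: "norm (((\<lambda>x. transpose (rot \<tau>) *v x) ^^ Suc j) \<omega> - \<omega>) \<le> e / 3"
    using orthogonal_power_return[of "transpose (rot \<tau>)" "e / 3" \<omega>] orthogonal_rot[OF \<tau>(1)] \<open>0 < e\<close>
    by auto
  define \<tau>' where "\<tau>' = concat (replicate j \<tau>)"
  define \<gamma> where "\<gamma> = concat (replicate (Suc j) \<tau>)"
  \<comment> \<open>The first copy of \<open>\<tau>\<close> alone brings every image close to
    \<open>a\<close>; the remaining copies only correct the rotation.\<close>
  have \<gamma>: "\<gamma> = \<tau> @ \<tau>'" "\<tau>' \<in> W" "\<gamma> \<in> W"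
    unfolding \<gamma>_def \<tau>'_def by (simp, rule power_word_in_W[OF \<tau>(1)], rule power_word_in_W[OF \<tau>(1)])
  have rot_\<gamma>: "norm (transpose (rot \<gamma>) *v \<omega> - \<omega>) \<le> e / 3"
    using j unfolding \<gamma>_def rot_power_word .
  have near_a: "norm (word_map S \<gamma> x - a) \<le> ratio \<tau> * R * (1 + norm x)" for x
  proof -
    have "norm (word_map S \<tau>' x - a') \<le> norm x + 3 * attractor_bound"
      using norm_word_map_le[OF \<gamma>(2), of x] attractor_bound(2)[OF \<tau>(3)]
        norm_triangle_ineq4[of "word_map S \<tau>' x" a'] by linarith
    also have "\<dots> \<le> R * (1 + norm x)"
      using attractor_bound(1) by (simp add: R_def algebra_simps)
    finally have "ratio \<tau> * norm (word_map S \<tau>' x - a') \<le> ratio \<tau> * (R * (1 + norm x))"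
      using ratio_pos[OF \<tau>(1)] by (intro mult_left_mono) auto
    then show ?thesis
      using norm_word_map_diff[OF \<tau>(1), of "word_map S \<tau>' x" a']
      by (simp add: \<gamma>(1) \<tau>(4) word_map_append mult.assoc)
  qed
  define h where "h k = norm (\<Phi> (r k) a)" for k
  have "h \<longlonglongrightarrow> 0"
  proof (rule Lim_null_comparison[OF always_eventually[OF allI]])
    show "norm (h k) \<le> (1 + 2 * (\<Sum>i\<in>UNIV. \<bar>a $ i\<bar>)) * cube_sup_norm (\<Phi> (r k))" for k
      using norm_displacement_le[OF W] by (simp add: h_def \<Phi>)
    show "(\<lambda>k. (1 + 2 * (\<Sum>i\<in>UNIV. \<bar>a $ i\<bar>)) * cube_sup_norm (\<Phi> (r k))) \<longlonglongrightarrow> 0"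
      using LIMSEQ_subseq_LIMSEQ[OF sup_lim r] by (intro tendsto_mult_right_zero) (simp add: o_def)
  qed
  moreover have "0 < ratio \<gamma> / (\<bar>N\<bar> + 1)"
    using ratio_pos[OF \<gamma>(3)] by (simp add: add_nonneg_pos)
  ultimately have "\<forall>\<^sub>F k in sequentially. h k < ratio \<gamma> / (\<bar>N\<bar> + 1)"
    by (rule order_tendstoD)
  moreover have "\<forall>\<^sub>F k in sequentially. dist (\<Phi> (r k) a /\<^sub>R norm (\<Phi> (r k) a)) \<omega> < min (e / 3) 1"
    using \<open>0 < e\<close> by (intro tendstoD[OF lim]) simp
  ultimately have "\<forall>\<^sub>F k in sequentially. h k < ratio \<gamma> / (\<bar>N\<bar> + 1) \<and>
      dist (\<Phi> (r k) a /\<^sub>R norm (\<Phi> (r k) a)) \<omega> < min (e / 3) 1"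
    by (rule eventually_conj)
  then obtain k where k: "h k < ratio \<gamma> / (\<bar>N\<bar> + 1)"
      "dist (\<Phi> (r k) a /\<^sub>R norm (\<Phi> (r k) a)) \<omega> < min (e / 3) 1"
    using eventually_happens'[OF sequentially_bot] by blast
  \<comment> \<open>A vanishing displacement would be normalised to 0, at distance 1 from the unit
    vector \<open>\<omega>\<close>; the bound by 1 in \<open>min (e / 3) 1\<close> excludes
    this.\<close>
  have "h k \<noteq> 0"
    using k(2) \<omega> by (auto simp: h_def)
  then have h_pos: "0 < h k"
    by (simp add: h_def)
  have dir: "norm (\<Phi> (r k) a /\<^sub>R h k - \<omega>) \<le> e / 3"
    using k(2) by (simp add: h_def dist_norm)
  \<comment> \<open>Division by \<open>h k\<close> normalises the displacement at \<open>a\<close>,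
    and \<open>ratio \<gamma>\<close> undoes the magnification by the zoom.\<close>
  define t where "t = ratio \<gamma> / h k"
  have "h k * (\<bar>N\<bar> + 1) < ratio \<gamma>"
    using k(1) by (simp add: pos_less_divide_eq add_nonneg_pos)
  then have "\<bar>N\<bar> + 1 < t"
    using h_pos by (simp add: t_def pos_less_divide_eq mult.commute)
  moreover have "near (\<alpha> (r k) @ \<gamma>) (\<beta> (r k) @ \<gamma>) t e \<omega>"
    unfolding near_def
  proof
    fix x :: "real^'n"
    let ?T = "transpose (rot \<gamma>)" and ?y = "word_map S \<gamma> x"
    have "t *\<^sub>R displacement S (\<alpha> (r k) @ \<gamma>) (\<beta> (r k) @ \<gamma>) x = ?T *v (\<Phi> (r k) ?y /\<^sub>R h k)"
      using ratio_pos[OF \<gamma>(3)] unfolding displacement_append_right[OF W(1) \<gamma>(3)]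
      by (simp add: t_def \<Phi> matrix_vector_mult_scaleR divide_inverse)
    also have "\<Phi> (r k) ?y = \<Phi> (r k) a + M (r k) *v (?y - a)"
      unfolding \<Phi> M_def by (rule displacement_affine[OF W])
    \<comment> \<open>The three terms are the variation away from \<open>a\<close>, the error of the
      direction at \<open>a\<close> and the remaining rotation; each receives a third of the allowed
      error.\<close>
    finally have "t *\<^sub>R displacement S (\<alpha> (r k) @ \<gamma>) (\<beta> (r k) @ \<gamma>) x - \<omega>
        = ?T *v ((M (r k) *v (?y - a)) /\<^sub>R h k) + ?T *v (\<Phi> (r k) a /\<^sub>R h k - \<omega>) + (?T *v \<omega> - \<omega>)"
      by (simp add: matrix_vector_right_distrib matrix_vector_mult_diff_distrib scaleR_add_right)
    also have "norm \<dots> \<le> norm ((M (r k) *v (?y - a)) /\<^sub>R h k)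
        + norm (\<Phi> (r k) a /\<^sub>R h k - \<omega>) + norm (?T *v \<omega> - \<omega>)"
      by (rule order_trans[OF order_trans[OF norm_triangle_ineq add_right_mono[OF norm_triangle_ineq]]])
        (simp add: norm_orthogonal_matrix_vector orthogonal_rot[OF \<gamma>(3)])
    also have "norm ((M (r k) *v (?y - a)) /\<^sub>R h k) \<le> e / 3 * (1 + norm x)"
    proof -
      have "norm (M (r k) *v (?y - a)) \<le> h k / \<rho> * norm (?y - a)"
        unfolding h_def by (rule deriv_le)
      also have "\<dots> \<le> h k / \<rho> * (ratio \<tau> * R * (1 + norm x))"
        using h_pos \<rho> by (intro mult_left_mono near_a) auto
      finally have "norm ((M (r k) *v (?y - a)) /\<^sub>R h k) \<le> ratio \<tau> * R / \<rho> * (1 + norm x)"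
        using h_pos by (simp add: field_simps)
      also have "\<dots> \<le> e / 3 * (1 + norm x)"
        by (intro mult_right_mono ratio_\<tau>) simp
      finally show ?thesis .
    qed
    also have "e / 3 * (1 + norm x) + norm (\<Phi> (r k) a /\<^sub>R h k - \<omega>) + norm (?T *v \<omega> - \<omega>)
        \<le> e / 3 * (1 + norm x) + e / 3 * (1 + norm x) + e / 3 * (1 + norm x)"
    proof -
      have "e / 3 \<le> e / 3 * (1 + norm x)"
        using \<open>0 < e\<close> by (simp add: algebra_simps)
      then show ?thesis
        using dir rot_\<gamma> by linarith
    qed
    finally show "norm (t *\<^sub>R displacement S (\<alpha> (r k) @ \<gamma>) (\<beta> (r k) @ \<gamma>) x - \<omega>) \<le> e * (1 + norm x)"
      by simp
  qed
  ultimately show "\<exists>t>N. \<exists>\<alpha>\<in>words m. \<exists>\<beta>\<in>words m. near \<alpha> \<beta> t e \<omega>"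
    using words_append[OF words(1) \<gamma>(3)] words_append[OF words(2) \<gamma>(3)]
    by (intro exI[of _ t]) fastforce
qed

text \<open>Overlapping directions lie in the subspace of translation limits, hence so does their
  span. Conversely, a nonzero translation limit is a multiple of an overlapping direction, obtained
  by normalising it.\<close>

lemma overlap_space_eq: "overlap_space m S F = {v. translation_limit v}"
proof
  show "overlap_space m S F \<subseteq> {v. translation_limit v}"
    unfolding overlap_space_def
    by (intro span_minimal subspace_translation_limit) (auto intro: overlapping_directionD)
  show "{v. translation_limit v} \<subseteq> overlap_space m S F"
  proof
    fix v
    assume "v \<in> {v. translation_limit v}"
    then have v: "translation_limit v"
      by simp
    show "v \<in> overlap_space m S F"
    proof (cases "v = 0")
      case False
      then have "overlapping_direction m S F (inverse (norm v) *\<^sub>R v)"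
        by (intro overlapping_directionI translation_limit_scale v) auto
      then have "norm v *\<^sub>R (inverse (norm v) *\<^sub>R v) \<in> overlap_space m S F"
        unfolding overlap_space_def by (intro span_scale span_base) simp
      then show ?thesis
        using False by simp
    qed (simp add: overlap_space_def span_zero)
  qed
qed

end

theorem theorem4p1:
  fixes m :: nat
    and S :: "nat \<Rightarrow> real^'n \<Rightarrow> real^'n"
    and c :: "nat \<Rightarrow> real"
    and Q :: "nat \<Rightarrow> real^'n^'n"
    and b :: "nat \<Rightarrow> real^'n"
    and F :: "(real^'n) set"
  assumes "ifs m S c Q b"
    and "is_attractor m S F"
    and "\<not> in_some_hyperplane F"
  shows "(\<forall>v\<in>overlap_space m S F. norm v = 1 \<longrightarrow> overlapping_direction m S F v) \<and>
         (\<forall>A\<in>rotation_group m Q. \<forall>v\<in>overlap_space m S F. A *v v \<in> overlap_space m S F)"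
proof -
  interpret self_similar m S c Q b F
    using assms(1,2) by unfold_locales
  show ?thesis
    by (auto simp: overlap_space_eq intro: overlapping_directionI translation_limit_rotation_group)
qed

end
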